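(* Let $E$ be a normed space, let $B_{E^*}$ be the closed unit ball of $E^*$ with the weak* topology $\mathrm{w}^*$, and let $F:=C_{\mathrm{ph}}(B_{E^*},\mathrm{w}^* )$. The following conditions are equivalent: (i) $\dim E<\infty$; (ii) $F$ is a regular sublattice of $C(B_{E^*},\mathrm{w}^* )$; (iii) $F$ is $1$-monotonically bounded; (iv) $F$ is semicontinuous, that is, $B_F$ is order closed in $F$; (v) $F$ is pointwise demicontinuous; (vi) $F$ is not anti-demicontinuous, that is, the order adherence of $B_F$ in $F$ is not equal to $F$.
   Context: Normed spaces are real. $C(B_{E^*},\mathrm{w}^* )$ is the Banach lattice of real weak* continuous functions on $B_{E^*}$ with the supremum norm, and $C_{\mathrm{ph}}(B_{E^*},\mathrm{w}^* )$ is its closed sublattice of positively homogeneous functions, i.e. those $f$ with $f(tx)=tf(x)$ for all $x\in B_{E^*}$, $0\le t\le1$. $B_F$ is the closed unit ball of $F$ and $B_{F_+}=B_F\cap F_+$. $P\uparrow f$ ($P\downarrow f$) means that $P$ is upward (downward) directed with supremum (infimum) $f$. A sublattice $H$ of a vector lattice $G$ is regular if whenever $P\subset H$ has infimum $0$ in $H$, it has infimum $0$ in $G$. A net $(f_p)$ in $F$ order converges to $f$ if there is $Q\subset F$ with $Q\downarrow 0$ such that for every $q\in Q$ there is $p_q$ with $|f_p-f|\le q$ whenever $p\ge p_q$. The order adherence of a set is the set of all order limits of nets of its elements; a set is order closed if it equals its order adherence. $F$ is $1$-monotonically bounded if every upward directed subset of $B_{F_+}$ has an upper bound in $B_F$.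 $F$ is semicontinuous if whenever $P\subset B_{F_+}$ and $P\uparrow f\in F$, then $\|f\|\le1$. $F$ is pointwise demicontinuous if for every $0<f\in F$ there is $t>0$ such that whenever $P\subset sB_{F_+}$ satisfies $P\uparrow f$, then $s\ge t$. $F$ is anti-demicontinuous if for every $f\in F_+$ there is $P\subset B_{F_+}$ with $P\uparrow f$ (equivalently, the order adherence of $B_F$ is $F$).
   Formalization: The equivalence with (vi) is stated for E ≠ {0}, since for E = {0} we have F = {0}, so (i) holds but F is anti-demicontinuous; infima in the definition of a regular sublattice are those of nonempty sets, which matters only for E = {0}. *)

theory Defs
  imports "HOL-Analysis.Analysis" "HOL-Library.Lub_Glb" "HOL-Library.Function_Algebras"
begin

section \<open>Function lattices\<close>

text \<open>
  All vector lattices below are sets of functions \<open>'x \<Rightarrow> real\<close>, with the pointwise order and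
  operations.  Suprema and infima of subsets are nevertheless always relative to the lattice in
  question: \<^term>\<open>isLub F P f\<close> (resp. \<^term>\<open>isGlb F P f\<close>) says that \<open>f \<in> F\<close> is the least upper
  (greatest lower) bound of \<open>P\<close> among the elements of \<open>F\<close>; it need not be the pointwise
  supremum (infimum).
\<close>

definition sublattice :: "('x \<Rightarrow> real) set \<Rightarrow> ('x \<Rightarrow> real) set \<Rightarrow> bool" where
  "sublattice H G \<longleftrightarrow> H \<subseteq> G \<and> 0 \<in> H \<and>
     (\<forall>f\<in>H. \<forall>g\<in>H. f + g \<in> H \<and> sup f g \<in> H \<and> inf f g \<in> H) \<and>
     (\<forall>f\<in>H. \<forall>c. (\<lambda>x. c * f x) \<in> H)"

text \<open>Infima are those of nonempty sets (this only matters for \<open>H = {0}\<close>, where the empty set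
  has infimum \<open>0\<close>).\<close>

definition regular_sublattice :: "('x \<Rightarrow> real) set \<Rightarrow> ('x \<Rightarrow> real) set \<Rightarrow> bool" where
  "regular_sublattice H G \<longleftrightarrow> sublattice H G \<and>
     (\<forall>P. P \<subseteq> H \<and> P \<noteq> {} \<and> isGlb H P 0 \<longrightarrow> isGlb G P 0)"

definition up_directed :: "'a::order set \<Rightarrow> bool" where
  "up_directed P \<longleftrightarrow> P \<noteq> {} \<and> (\<forall>a\<in>P. \<forall>b\<in>P. \<exists>c\<in>P. a \<le> c \<and> b \<le> c)"

definition down_directed :: "'a::order set \<Rightarrow> bool" where
  "down_directed P \<longleftrightarrow> P \<noteq> {} \<and> (\<forall>a\<in>P. \<forall>b\<in>P. \<exists>c\<in>P. c \<le> a \<and> c \<le> b)"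

definition increases_to :: "('x \<Rightarrow> real) set \<Rightarrow> ('x \<Rightarrow> real) set \<Rightarrow> ('x \<Rightarrow> real) \<Rightarrow> bool" where
  "increases_to F P f \<longleftrightarrow> P \<subseteq> F \<and> up_directed P \<and> isLub F P f"

definition decreases_to :: "('x \<Rightarrow> real) set \<Rightarrow> ('x \<Rightarrow> real) set \<Rightarrow> ('x \<Rightarrow> real) \<Rightarrow> bool" where
  "decreases_to F P f \<longleftrightarrow> P \<subseteq> F \<and> down_directed P \<and> isGlb F P f"


section \<open>Order convergence\<close>

definition directed_index :: "'i set \<Rightarrow> ('i \<Rightarrow> 'i \<Rightarrow> bool) \<Rightarrow> bool" where
  "directed_index I r \<longleftrightarrow> I \<noteq> {} \<and> reflp_on I r \<and> transp_on I r \<and>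
     (\<forall>i\<in>I. \<forall>j\<in>I. \<exists>k\<in>I. r i k \<and> r j k)"

definition order_converges ::
    "('x \<Rightarrow> real) set \<Rightarrow> 'i set \<Rightarrow> ('i \<Rightarrow> 'i \<Rightarrow> bool) \<Rightarrow> ('i \<Rightarrow> 'x \<Rightarrow> real) \<Rightarrow> ('x \<Rightarrow> real) \<Rightarrow> bool" where
  "order_converges F I r n f \<longleftrightarrow> n ` I \<subseteq> F \<and> f \<in> F \<and>
     (\<exists>Q. decreases_to F Q 0 \<and>
        (\<forall>q\<in>Q. \<exists>i\<in>I. \<forall>p\<in>I. r i p \<longrightarrow> (\<forall>x. \<bar>n p x - f x\<bar> \<le> q x)))"

text \<open>
  The index sets of the nets are subsets of the type \<open>'x \<Rightarrow> real\<close> of the functions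
  themselves.  This is no restriction: by \<open>order_adherenceI\<close> below, limits of nets with
  index sets of an arbitrary type are obtained as well.
\<close>

definition order_adherence :: "('x \<Rightarrow> real) set \<Rightarrow> ('x \<Rightarrow> real) set \<Rightarrow> ('x \<Rightarrow> real) set" where
  "order_adherence F A = {f. \<exists>(I :: ('x \<Rightarrow> real) set) r n.
     directed_index I r \<and> n ` I \<subseteq> A \<and> order_converges F I r n f}"

lemma order_adherenceI:
  fixes I :: "'i set"
  assumes I: "directed_index I r" and A: "n ` I \<subseteq> A" and conv: "order_converges F I r n f"
  shows "f \<in> order_adherence F A"
proof -
  from conv obtain Q where Q: "decreases_to F Q 0" and f: "f \<in> F" and nF: "n ` I \<subseteq> F"
    and "\<forall>q\<in>Q. \<exists>i\<in>I. \<forall>p\<in>I. r i p \<longrightarrow> (\<forall>x. \<bar>n p x - f x\<bar> \<le> q x)"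
    unfolding order_converges_def by blast
  then obtain i where i: "\<And>q. q \<in> Q \<Longrightarrow> i q \<in> I"
    and bound: "\<And>q p x. q \<in> Q \<Longrightarrow> p \<in> I \<Longrightarrow> r (i q) p \<Longrightarrow> \<bar>n p x - f x\<bar> \<le> q x"
    by metis
  let ?r = "\<lambda>q q'. q' \<le> q"
  have "directed_index Q ?r"
    using Q unfolding directed_index_def decreases_to_def down_directed_def
    by (auto simp: reflp_on_def transp_on_def)
  moreover have "(n \<circ> i) ` Q \<subseteq> A" "(n \<circ> i) ` Q \<subseteq> F"
    using i A nF by auto
  moreover have "\<bar>(n \<circ> i) q' x - f x\<bar> \<le> q x" if "q \<in> Q" "q' \<in> Q" "q' \<le> q" for q q' x
  proof -
    have "r (i q') (i q')"
      using I i[OF that(2)] by (auto simp: directed_index_def reflp_on_def)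
    then have "\<bar>n (i q') x - f x\<bar> \<le> q' x"
      using bound i that(2) by blast
    also have "\<dots> \<le> q x"
      using that(3) by (simp add: le_fun_def)
    finally show ?thesis by simp
  qed
  ultimately have "order_converges F Q ?r (n \<circ> i) f"
    unfolding order_converges_def using Q f by blast
  then show ?thesis
    unfolding order_adherence_def using \<open>directed_index Q ?r\<close> \<open>(n \<circ> i) ` Q \<subseteq> A\<close> by blast
qed

definition order_closed :: "('x \<Rightarrow> real) set \<Rightarrow> ('x \<Rightarrow> real) set \<Rightarrow> bool" where
  "order_closed F A \<longleftrightarrow> order_adherence F A = A"


section \<open>Properties of a normed lattice of functions\<close>

text \<open>In the following, \<open>nrm\<close> is the norm of the lattice \<open>F\<close>.\<close>

definition unit_ball :: "('x \<Rightarrow> real) set \<Rightarrow> (('x \<Rightarrow> real) \<Rightarrow> real) \<Rightarrow> ('x \<Rightarrow> real) set" where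
  "unit_ball F nrm = {f \<in> F. nrm f \<le> 1}"

definition pos_unit_ball :: "('x \<Rightarrow> real) set \<Rightarrow> (('x \<Rightarrow> real) \<Rightarrow> real) \<Rightarrow> ('x \<Rightarrow> real) set" where
  "pos_unit_ball F nrm = {f \<in> unit_ball F nrm. 0 \<le> f}"

definition one_monotonically_bounded ::
    "('x \<Rightarrow> real) set \<Rightarrow> (('x \<Rightarrow> real) \<Rightarrow> real) \<Rightarrow> bool" where
  "one_monotonically_bounded F nrm \<longleftrightarrow>
     (\<forall>P. P \<subseteq> pos_unit_ball F nrm \<and> up_directed P \<longrightarrow> (\<exists>u\<in>unit_ball F nrm. \<forall>p\<in>P. p \<le> u))"

definition semicontinuous :: "('x \<Rightarrow> real) set \<Rightarrow> (('x \<Rightarrow> real) \<Rightarrow> real) \<Rightarrow> bool" where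
  "semicontinuous F nrm \<longleftrightarrow>
     (\<forall>P. \<forall>f\<in>F. P \<subseteq> pos_unit_ball F nrm \<and> increases_to F P f \<longrightarrow> nrm f \<le> 1)"

definition pointwise_demicontinuous ::
    "('x \<Rightarrow> real) set \<Rightarrow> (('x \<Rightarrow> real) \<Rightarrow> real) \<Rightarrow> bool" where
  "pointwise_demicontinuous F nrm \<longleftrightarrow>
     (\<forall>f\<in>F. 0 < f \<longrightarrow>
        (\<exists>t>0. \<forall>s P. P \<subseteq> (\<lambda>g x. s * g x) ` pos_unit_ball F nrm \<and> increases_to F P f \<longrightarrow> s \<ge> t))"

definition anti_demicontinuous :: "('x \<Rightarrow> real) set \<Rightarrow> (('x \<Rightarrow> real) \<Rightarrow> real) \<Rightarrow> bool" where
  "anti_demicontinuous F nrm \<longleftrightarrow>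
     (\<forall>f\<in>F. 0 \<le> f \<longrightarrow> (\<exists>P. P \<subseteq> pos_unit_ball F nrm \<and> increases_to F P f))"


section \<open>Weak* continuous functions on the dual unit ball\<close>

text \<open>
  The dual of \<open>'a\<close> is \<open>'a \<Rightarrow>\<^sub>L real\<close>.  For scalar-valued operators the strong operator topology,
  i.e. the topology of pointwise convergence, is the weak* topology.
\<close>

abbreviation weak_star_topology :: "('a::real_normed_vector \<Rightarrow>\<^sub>L real) topology" where
  "weak_star_topology \<equiv> strong_operator_topology"

abbreviation dual_ball :: "('a::real_normed_vector \<Rightarrow>\<^sub>L real) set" where
  "dual_ball \<equiv> cball 0 1"

text \<open>
  Functions on the dual ball are represented by their extensions by zero to the whole dual, so
  that distinct functions have distinct representatives and the order and the operations of the
  function space are those of functions on the ball.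
\<close>

definition C_ball :: "(('a::real_normed_vector \<Rightarrow>\<^sub>L real) \<Rightarrow> real) set" where
  "C_ball = {f. continuous_map (subtopology weak_star_topology dual_ball) euclideanreal f \<and>
     (\<forall>x. x \<notin> dual_ball \<longrightarrow> f x = 0)}"

definition Cph_ball :: "(('a::real_normed_vector \<Rightarrow>\<^sub>L real) \<Rightarrow> real) set" where
  "Cph_ball = {f \<in> C_ball. \<forall>x\<in>dual_ball. \<forall>t\<in>{0..1}. f (t *\<^sub>R x) = t * f x}"

text \<open>This is the genuine supremum norm on \<^const>\<open>C_ball\<close>, since the dual ball is nonempty and
  weak* compact.\<close>

definition sup_norm :: "(('a::real_normed_vector \<Rightarrow>\<^sub>L real) \<Rightarrow> real) \<Rightarrow> real" where
  "sup_norm f = (SUP x\<in>dual_ball. \<bar>f x\<bar>)"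

definition finite_dimensional :: "'a::real_vector itself \<Rightarrow> bool" where
  "finite_dimensional _ \<longleftrightarrow> (\<exists>B::'a set. finite B \<and> span B = UNIV)"

end

theory Submission
  imports Defs
begin

text \<open>
  Everything depends on whether the norm is weak* continuous on the dual ball.  If \<open>dim E < \<infinity>\<close>,
  it is, and hence it is the largest element of the unit ball of \<open>F\<close>.  If \<open>dim E = \<infinity>\<close>,
  every weak* neighbourhood contains a translate of the annihilator of a finite set, so every \<open>f \<ge> 0\<close> in \<open>F\<close> is
  the supremum in \<open>F\<close> of its minorants in the unit ball: a smaller upper bound \<open>h\<close> would satisfy
  \<open>h x < f x < norm x\<close> for some \<open>x\<close>, and then \<open>inf f e\<close> exceeds \<open>h\<close> at \<open>x\<close> for the positive part
  \<open>e\<close> of a suitable evaluation.  Thus \<open>F\<close> is anti-demicontinuous, which contradicts each of the other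
  conditions.
\<close>

section \<open>Finite-dimensional subspaces\<close>

text \<open>Everything turns on what finitely many evaluations can see. In finite dimensions they
  bound the norm of a functional, so weak* and norm continuity agree. In infinite dimensions they
  never do: Hahn-Banach, applied to the distance from the span of finitely many vectors, yields a
  functional of norm 1 that vanishes on all of them. The obstacle throughout is that suprema and
  infima are relative to \<open>F\<close>, so a pointwise bound helps only after it has been
  realised inside \<open>F\<close>: by the norm itself for the order conditions, by a homogenised
  minorant for regularity, by \<open>inf f e\<close> in infinite dimensions. The contradictions with
  anti-demicontinuity use only that E is nonzero. For E = 0 the lattice is {0}, which is
  anti-demicontinuous although the dimension is finite; this is why the two forms of (vi) are
  restricted to nonzero E.\<close>

lemma compact_bounded_combinations:
  fixes B :: "'a::real_normed_vector set"
  assumes "finite B"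
  shows "compact {\<Sum>b\<in>B. c b *\<^sub>R b | c. \<forall>b\<in>B. \<bar>c b\<bar> \<le> 1}"
  using assms
proof (induction B rule: finite_induct)
  case (insert a B)
  let ?D = "{\<Sum>b\<in>B. c b *\<^sub>R b | c. \<forall>b\<in>B. \<bar>c b\<bar> \<le> 1}"
  let ?A = "(\<lambda>t. t *\<^sub>R a) ` {-1..1}"
  \<comment> \<open>Splitting off the coefficient of \<open>a\<close> makes the set the sum of a
    compact segment and the set for \<open>B\<close>.\<close>
  have eq: "{\<Sum>b\<in>insert a B. c b *\<^sub>R b | c. \<forall>b\<in>insert a B. \<bar>c b\<bar> \<le> 1}
      = {x + y | x y. x \<in> ?A \<and> y \<in> ?D}" (is "?L = ?R")
  proof (intro equalityI subsetI)
    fix v assume "v \<in> ?L"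
    then obtain c where "v = c a *\<^sub>R a + (\<Sum>b\<in>B. c b *\<^sub>R b)" "\<bar>c a\<bar> \<le> 1" "\<forall>b\<in>B. \<bar>c b\<bar> \<le> 1"
      using insert.hyps by auto
    moreover from this have "c a *\<^sub>R a \<in> ?A" by (intro imageI) (auto simp: abs_le_iff)
    ultimately show "v \<in> ?R" by blast
  next
    fix v assume "v \<in> ?R"
    then obtain t c where v: "v = t *\<^sub>R a + (\<Sum>b\<in>B. c b *\<^sub>R b)" "t \<in> {-1..1}" "\<forall>b\<in>B. \<bar>c b\<bar> \<le> 1"
      by blast
    have "(\<Sum>b\<in>B. (c(a := t)) b *\<^sub>R b) = (\<Sum>b\<in>B. c b *\<^sub>R b)"
      using insert.hyps by (intro sum.cong) auto
    then have "v = (\<Sum>b\<in>insert a B. (c(a := t)) b *\<^sub>R b)"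
      using insert.hyps v by simp
    moreover have "\<forall>b\<in>insert a B. \<bar>(c(a := t)) b\<bar> \<le> 1"
      using v by (auto simp: abs_le_iff)
    ultimately show "v \<in> ?L" by blast
  qed
  have "compact ?A"
    by (intro compact_continuous_image continuous_intros) auto
  then show ?case
    unfolding eq using insert.IH by (rule compact_sums)
qed auto

text \<open>Divide by the coefficient of largest modulus, say that of \<open>a\<close>. The
  remaining terms then form, up to sign, a point of a compact set that misses \<open>a\<close> by
  independence, hence stays at positive distance from it; \<open>d\<close> is the least of these
  distances.\<close>

lemma independent_coefficients_le_norm:
  fixes B :: "'a::real_normed_vector set"
  assumes "finite B" "independent B"
  obtains d where "d > 0" "\<And>c b. b \<in> B \<Longrightarrow> d * \<bar>c b\<bar> \<le> norm (\<Sum>b\<in>B. c b *\<^sub>R b)"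
proof -
  define D where "D a = {\<Sum>b\<in>B - {a}. c b *\<^sub>R b | c. \<forall>b\<in>B - {a}. \<bar>c b\<bar> \<le> 1}" for a
  have pos: "infdist (- a) (D a) > 0" if "a \<in> B" for a
  proof -
    have "closed (D a)"
      unfolding D_def using assms(1) by (intro compact_imp_closed compact_bounded_combinations) auto
    moreover have "D a \<noteq> {}"
      unfolding D_def by (auto intro!: exI[of _ "\<lambda>_. 0"])
    moreover have "- a \<notin> D a"
    proof
      assume "- a \<in> D a"
      then obtain c where "- a = (\<Sum>b\<in>B - {a}. c b *\<^sub>R b)"
        unfolding D_def by blast
      also have "\<dots> \<in> span (B - {a})"
        by (intro span_sum span_scale span_base)
      finally show False
        using assms(2) that span_neg[of "- a" "B - {a}"] by (auto simp: dependent_def)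
    qed
    ultimately show ?thesis
      by (metis infdist_pos_not_in_closed)
  qed
  \<comment> \<open>The inserted 1 keeps the minimum meaningful for empty \<open>B\<close>.\<close>
  define d where "d = Min (insert 1 ((\<lambda>a. infdist (- a) (D a)) ` B))"
  have "d > 0"
    unfolding d_def using assms(1) pos by (subst Min_gr_iff) auto
  moreover have "d * \<bar>c b0\<bar> \<le> norm (\<Sum>b\<in>B. c b *\<^sub>R b)" if b0: "b0 \<in> B" for c b0
  proof -
    obtain a where a: "a \<in> B" "\<And>b. b \<in> B \<Longrightarrow> \<bar>c b\<bar> \<le> \<bar>c a\<bar>"
    proof -
      have "Max ((\<lambda>b. \<bar>c b\<bar>) ` B) \<in> (\<lambda>b. \<bar>c b\<bar>) ` B"
        using assms(1) b0 by (intro Max_in) auto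
      then obtain a where "a \<in> B" "Max ((\<lambda>b. \<bar>c b\<bar>) ` B) = \<bar>c a\<bar>"
        by auto
      then show ?thesis
        using that assms(1) by (metis Max_ge finite_imageI imageI)
    qed
    show ?thesis
    proof (cases "c a = 0")
      case True
      then show ?thesis using a(2)[OF b0] by simp
    next
      case False
      define w where "w = (\<Sum>b\<in>B - {a}. (c b / c a) *\<^sub>R b)"
      have "w \<in> D a"
        unfolding D_def w_def using a(2) False
        by (intro CollectI exI[of _ "\<lambda>b. c b / c a"]) (auto simp: abs_divide)
      have "(\<Sum>b\<in>B. c b *\<^sub>R b) = c a *\<^sub>R a + (\<Sum>b\<in>B - {a}. c b *\<^sub>R b)"
        using assms(1) a(1) by (rule sum.remove)
      also have "\<dots> = c a *\<^sub>R (a + w)"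
        using False by (simp add: w_def scaleR_sum_right scaleR_add_right)
      finally have "norm (\<Sum>b\<in>B. c b *\<^sub>R b) = \<bar>c a\<bar> * dist (- a) w"
        by (simp add: dist_norm norm_minus_commute add.commute)
      also have "\<dots> \<ge> \<bar>c a\<bar> * d"
      proof (rule mult_left_mono)
        have "d \<le> infdist (- a) (D a)"
          unfolding d_def using assms(1) a(1) by (intro Min_le) auto
        also have "\<dots> \<le> dist (- a) w"
          using \<open>w \<in> D a\<close> by (rule infdist_le)
        finally show "d \<le> dist (- a) w" .
      qed simp
      finally have "\<bar>c a\<bar> * d \<le> norm (\<Sum>b\<in>B. c b *\<^sub>R b)" .
      moreover have "\<bar>c b0\<bar> * d \<le> \<bar>c a\<bar> * d"
        using a(2)[OF b0] \<open>d > 0\<close> by simp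
      ultimately show ?thesis by (simp add: mult.commute)
    qed
  qed
  ultimately show ?thesis using that by blast
qed

section \<open>The Hahn--Banach theorem\<close>

definition sublinear :: "('a::real_vector \<Rightarrow> real) \<Rightarrow> bool" where
  "sublinear p \<longleftrightarrow> (\<forall>x y. p (x + y) \<le> p x + p y) \<and> (\<forall>x. \<forall>t\<ge>0. p (t *\<^sub>R x) = t * p x)"

lemma sublinear_add: "sublinear p \<Longrightarrow> p (x + y) \<le> p x + p y"
  and sublinear_scale: "sublinear p \<Longrightarrow> 0 \<le> t \<Longrightarrow> p (t *\<^sub>R x) = t * p x"
  by (auto simp: sublinear_def)

lemma sublinear_zero: "sublinear p \<Longrightarrow> p 0 = 0"
  using sublinear_scale[of p 0 0] by simp

lemma sublinear_minus: "sublinear p \<Longrightarrow> - p (- x) \<le> p x"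
  using sublinear_add[of p x "- x"] by (simp add: sublinear_zero)

text \<open>One inequality for positive factors suffices: applied to \<open>inverse t\<close> and
  \<open>t *\<^sub>R x\<close> it gives the reverse one.\<close>

lemma sublinearI:
  assumes add: "\<And>x y. p (x + y) \<le> p x + p y" and zero: "p 0 = 0"
    and scale: "\<And>x t. 0 < t \<Longrightarrow> p (t *\<^sub>R x) \<le> t * p x"
  shows "sublinear p"
proof -
  have "p (t *\<^sub>R x) = t * p x" if "t \<ge> 0" for t x
  proof (cases "t = 0")
    case False
    with that have t: "t > 0" by simp
    have "p x \<le> inverse t * p (t *\<^sub>R x)"
      using scale[of "inverse t" "t *\<^sub>R x"] t by simp
    then have "t * p x \<le> p (t *\<^sub>R x)"
      using t by (simp add: field_simps)
    with scale[OF t, of x] show ?thesis by linarith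
  qed (simp add: zero)
  then show ?thesis by (simp add: sublinear_def add)
qed

text \<open>The infimum over t \<ge> 0 of \<open>q (x + t *\<^sub>R z) - t * q z\<close> is finite,
  being bounded below by \<open>- q (- x)\<close>; t = 0 gives \<open>r \<le> q\<close> and t = 1
  gives the last inequality. If \<open>q\<close> is minimal, then r = q, and that inequality says
  that \<open>q\<close> is superadditive.\<close>

lemma sublinear_shift:
  fixes q :: "'a::real_vector \<Rightarrow> real"
  assumes q: "sublinear q"
  obtains r where "sublinear r" "r \<le> q" "\<And>x. r x \<le> q (x + z) - q z"
proof -
  define r where "r x = (INF t\<in>{0..}. q (x + t *\<^sub>R z) - t * q z)" for x
  have below: "- q (- x) \<le> q (x + t *\<^sub>R z) - t * q z" if "t \<ge> 0" for x t
    using sublinear_add[OF q, of "x + t *\<^sub>R z" "- x"] sublinear_scale[OF q that, of z] by simp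
  have le: "r x \<le> q (x + t *\<^sub>R z) - t * q z" if "t \<ge> 0" for x t
    unfolding r_def using that below
    by (intro cINF_lower) (auto intro!: bdd_belowI2)
  have ge: "u \<le> r x" if "\<And>t. t \<ge> 0 \<Longrightarrow> u \<le> q (x + t *\<^sub>R z) - t * q z" for u x
    unfolding r_def using that by (intro cINF_greatest) auto
  have "sublinear r"
  proof (rule sublinearI)
    fix x y
    \<comment> \<open>The parameter s + t bounds the left side by one term from each infimum; the
      two infima are then taken one after the other.\<close>
    have *: "r (x + y) \<le> (q (x + s *\<^sub>R z) - s * q z) + (q (y + t *\<^sub>R z) - t * q z)"
      if "s \<ge> 0" "t \<ge> 0" for s t
      using le[of "s + t" "x + y"] that sublinear_add[OF q, of "x + s *\<^sub>R z" "y + t *\<^sub>R z"]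
      by (simp add: algebra_simps)
    have "r (x + y) - (q (y + t *\<^sub>R z) - t * q z) \<le> r x" if "t \<ge> 0" for t
      using *[OF _ that] by (intro ge) (simp add: algebra_simps)
    then have "r (x + y) - r x \<le> r y"
      by (intro ge) (simp add: algebra_simps)
    then show "r (x + y) \<le> r x + r y" by simp
  next
    have "r 0 \<le> 0" using le[of 0 0] by (simp add: sublinear_zero[OF q])
    moreover have "0 \<le> r 0"
      by (rule ge) (simp add: sublinear_scale[OF q])
    ultimately show "r 0 = 0" by simp
  next
    fix x and c :: real assume c: "0 < c"
    have "r (c *\<^sub>R x) / c \<le> r x"
    proof (rule ge)
      fix t :: real assume t: "t \<ge> 0"
      have "r (c *\<^sub>R x) \<le> q (c *\<^sub>R (x + t *\<^sub>R z)) - (c * t) * q z"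
        using le[of "c * t" "c *\<^sub>R x"] c t by (simp add: scaleR_add_right)
      also have "\<dots> = c * (q (x + t *\<^sub>R z) - t * q z)"
        using c sublinear_scale[OF q, of c "x + t *\<^sub>R z"] by (simp add: right_diff_distrib)
      finally show "r (c *\<^sub>R x) / c \<le> q (x + t *\<^sub>R z) - t * q z"
        using c by (simp add: field_simps)
    qed
    then show "r (c *\<^sub>R x) \<le> c * r x" using c by (simp add: field_simps)
  qed
  moreover have "r \<le> q"
    using le[of 0] by (simp add: le_fun_def)
  moreover have "r x \<le> q (x + z) - q z" for x
    using le[of 1 x] by simp
  ultimately show ?thesis using that by blast
qed

text \<open>Zorn's lemma for the reversed order: the pointwise infimum of a chain is sublinear, and
  it is finite because every sublinear q \<le> p satisfies
  \<open>- p (- x) \<le> q x\<close>.\<close>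

lemma minimal_sublinear_exists:
  fixes p :: "'a::real_vector \<Rightarrow> real"
  assumes p: "sublinear p"
  obtains q where "sublinear q" "q \<le> p" "\<And>r. sublinear r \<Longrightarrow> r \<le> q \<Longrightarrow> r = q"
proof -
  let ?A = "{q. sublinear q \<and> q \<le> p}"
  let ?P = "\<lambda>f g :: 'a \<Rightarrow> real. g \<le> f"
  have "\<exists>m\<in>?A. \<forall>a\<in>?A. ?P m a \<longrightarrow> a = m"
  proof (rule predicate_Zorn)
    show "partial_order_on ?A (relation_of ?P ?A)"
      by (rule partial_order_on_relation_ofI) auto
  next
    fix C assume C: "C \<in> Chains (relation_of ?P ?A)"
    then have CA: "q \<in> ?A" if "q \<in> C" for q
      using that by (auto simp: Chains_def relation_of_def)
    have tot: "q \<le> q' \<or> q' \<le> q" if "q \<in> C" "q' \<in> C" for q q'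
      using C that by (auto simp: Chains_def relation_of_def)
    show "\<exists>u\<in>?A. \<forall>a\<in>C. ?P a u"
    proof (cases "C = {}")
      case True
      then show ?thesis using p by blast
    next
      case False
      define u where "u x = (INF q\<in>C. q x)" for x
      have below: "- p (- x) \<le> q x" if "q \<in> C" for q x
      proof -
        have "sublinear q" "q (- x) \<le> p (- x)"
          using CA[OF that] by (auto simp: le_fun_def)
        then show ?thesis using sublinear_minus[of q x] by linarith
      qed
      have le: "u x \<le> q x" if "q \<in> C" for q x
        unfolding u_def using that below by (intro cINF_lower) (auto intro!: bdd_belowI2)
      have ge: "v \<le> u x" if "\<And>q. q \<in> C \<Longrightarrow> v \<le> q x" for v x
        unfolding u_def using that False by (intro cINF_greatest)
      have "sublinear u"
      proof (rule sublinearI)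
        fix x y
        \<comment> \<open>Of two comparable members the smaller one, used at both points, gives the
          mixed bound.\<close>
        have *: "u (x + y) \<le> q x + q' y" if "q \<in> C" "q' \<in> C" for q q'
        proof -
          have "u (x + y) \<le> q x + q y" "u (x + y) \<le> q' x + q' y"
            using le[of _ "x + y"] that CA sublinear_add order_trans by (metis (lifting) mem_Collect_eq)+
          with tot[OF that] show ?thesis
            by (auto simp: le_fun_def intro: order_trans add_mono)
        qed
        have "u (x + y) - q' y \<le> u x" if "q' \<in> C" for q'
          using * that by (intro ge) (simp add: algebra_simps)
        then have "u (x + y) - u x \<le> u y"
          by (intro ge) (simp add: algebra_simps)
        then show "u (x + y) \<le> u x + u y" by simp
      next
        have "(\<lambda>q. q 0) ` C = {0}"
          using CA False by (auto simp: image_iff sublinear_zero)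
        then show "u 0 = 0"
          by (simp add: u_def)
      next
        fix x and c :: real assume c: "0 < c"
        have "u (c *\<^sub>R x) / c \<le> u x"
        proof (rule ge)
          fix q assume "q \<in> C"
          then show "u (c *\<^sub>R x) / c \<le> q x"
            using le[of q "c *\<^sub>R x"] CA[of q] c by (simp add: sublinear_scale field_simps)
        qed
        then show "u (c *\<^sub>R x) \<le> c * u x" using c by (simp add: field_simps)
      qed
      moreover obtain q where q: "q \<in> C" using False by blast
      then have "u \<le> p"
        using le[OF q] CA[OF q] by (auto simp: le_fun_def intro: order_trans)
      ultimately show ?thesis
        using le by (intro bexI[of _ u]) (auto simp: le_fun_def)
    qed
  qed
  then show ?thesis
    using that by (metis (mono_tags, lifting) mem_Collect_eq order_trans)
qed

text \<open>Minimal sublinear functionals are linear, since a shift does not change them.\<close>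

theorem hahn_banach_sublinear:
  fixes p :: "'a::real_vector \<Rightarrow> real"
  assumes p: "sublinear p"
  obtains f where "linear f" "f \<le> p" "f z = p z"
proof -
  \<comment> \<open>Shifting by \<open>z\<close> before minimising forces
    \<open>r (- z) \<le> - p z\<close>, which any linear f \<le> r turns into
    \<open>p z \<le> f z\<close>.\<close>
  obtain r where r: "sublinear r" "r \<le> p" "\<And>x. r x \<le> p (x + z) - p z"
    using sublinear_shift[OF p] by metis
  obtain f where f: "sublinear f" "f \<le> r" and min: "\<And>g. sublinear g \<Longrightarrow> g \<le> f \<Longrightarrow> g = f"
    using minimal_sublinear_exists[OF r(1)] by metis
  have add: "f (x + y) = f x + f y" for x y
  proof -
    obtain g where "sublinear g" "g \<le> f" "\<And>x. g x \<le> f (x + y) - f y"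
      using sublinear_shift[OF f(1)] by metis
    with min have "f x \<le> f (x + y) - f y" by metis
    then show ?thesis using sublinear_add[OF f(1), of x y] by simp
  qed
  have minus: "f (- x) = - f x" for x
    using add[of x "- x"] by (simp add: sublinear_zero[OF f(1)])
  have "f (t *\<^sub>R x) = t * f x" for t x
  proof (cases "t \<ge> 0")
    case False
    then have "f ((- t) *\<^sub>R x) = (- t) * f x"
      by (intro sublinear_scale[OF f(1)]) simp
    then show ?thesis by (simp add: minus)
  qed (simp add: sublinear_scale[OF f(1)])
  then have lin: "linear f"
    by (intro linearI) (auto simp: add)
  have fp: "f \<le> p" using f(2) r(2) by simp
  have "f (- z) \<le> r (- z)" using f(2) by (simp add: le_fun_def)
  also have "\<dots> \<le> - p z" using r(3)[of "- z"] by (simp add: sublinear_zero[OF p])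
  finally have "p z \<le> f z" by (simp add: minus)
  with fp have "f z = p z" by (simp add: le_fun_def order_antisym)
  with lin fp show ?thesis using that by blast
qed

section \<open>Norm-one functionals annihilating a finite set\<close>

text \<open>A linear functional dominated by this distance vanishes on \<open>S\<close> and has norm
  at most 1, so one use of Hahn-Banach delivers both properties.\<close>

lemma sublinear_infdist_subspace:
  fixes S :: "'a::real_normed_vector set"
  assumes S: "subspace S"
  shows "sublinear (\<lambda>x. infdist x S)"
proof (rule sublinearI)
  have ne: "S \<noteq> {}" using subspace_0[OF S] by blast
  have le: "infdist x S \<le> norm (x - m)" if "m \<in> S" for x m
    using infdist_le[OF that, of x] by (simp add: dist_norm)
  have ge: "v \<le> infdist x S" if "\<And>m. m \<in> S \<Longrightarrow> v \<le> norm (x - m)" for v x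
    unfolding infdist_def using ne that by (auto simp: dist_norm intro!: cINF_greatest)
  show "infdist (x + y) S \<le> infdist x S + infdist y S" for x y
  proof -
    have *: "infdist (x + y) S \<le> norm (x - m) + norm (y - m')" if "m \<in> S" "m' \<in> S" for m m'
    proof -
      have "infdist (x + y) S \<le> norm (x + y - (m + m'))"
        using that subspace_add[OF S] by (intro le)
      also have "\<dots> \<le> norm (x - m) + norm (y - m')"
        by (metis add_diff_add norm_triangle_ineq)
      finally show ?thesis .
    qed
    have "infdist (x + y) S - norm (y - m') \<le> infdist x S" if "m' \<in> S" for m'
      using * that by (intro ge) (simp add: algebra_simps)
    then have "infdist (x + y) S - infdist x S \<le> infdist y S"
      by (intro ge) (simp add: algebra_simps)
    then show ?thesis by simp
  qed
  show "infdist 0 S = 0" using subspace_0[OF S] by simp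
  show "infdist (c *\<^sub>R x) S \<le> c * infdist x S" if "0 < c" for x c
  proof -
    have "infdist (c *\<^sub>R x) S / c \<le> infdist x S"
    proof (rule ge)
      fix m assume "m \<in> S"
      then have "infdist (c *\<^sub>R x) S \<le> norm (c *\<^sub>R x - c *\<^sub>R m)"
        by (intro le subspace_scale[OF S])
      also have "\<dots> = c * norm (x - m)"
        using that by (simp flip: scaleR_diff_right)
      finally show "infdist (c *\<^sub>R x) S / c \<le> norm (x - m)"
        using that by (simp add: field_simps)
    qed
    then show ?thesis using that by (simp add: field_simps)
  qed
qed

text \<open>Adjoining \<open>z\<close> to a basis of the span keeps it independent, and z - m has
  coefficient 1 at \<open>z\<close> for every m in the span; its norm is therefore at least the
  constant of the coefficient estimate.\<close>

lemma infdist_span_finite_pos: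
  fixes z :: "'a::real_normed_vector"
  assumes "finite B" "z \<notin> span B"
  shows "infdist z (span B) > 0"
proof -
  obtain A where A: "A \<subseteq> B" "independent A" "B \<subseteq> span A"
    using maximal_independent_subset by blast
  have sp: "span A = span B"
    using A by (metis span_eq span_superset subset_trans)
  have "z \<notin> span A" using sp assms(2) by simp
  then have zA: "z \<notin> A" using span_base by blast
  have fin: "finite A" using A(1) assms(1) finite_subset by blast
  have "independent (insert z A)"
    using A(2) \<open>z \<notin> span A\<close> by (simp add: independent_insert)
  then obtain d where d: "d > 0"
    "\<And>c b. b \<in> insert z A \<Longrightarrow> d * \<bar>c b\<bar> \<le> norm (\<Sum>b\<in>insert z A. c b *\<^sub>R b)"
    using independent_coefficients_le_norm[of "insert z A"] fin by blast
  have "d \<le> dist z m" if m: "m \<in> span A" for m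
  proof -
    obtain u where u: "m = (\<Sum>b\<in>A. u b *\<^sub>R b)"
      using m unfolding span_finite[OF fin] by blast
    let ?c = "\<lambda>b. if b = z then 1 else - u b"
    have "(\<Sum>b\<in>A. ?c b *\<^sub>R b) = (\<Sum>b\<in>A. - (u b *\<^sub>R b))"
      using zA by (intro sum.cong) auto
    then have "(\<Sum>b\<in>insert z A. ?c b *\<^sub>R b) = z - m"
      using zA fin u by (simp add: sum_negf)
    then show ?thesis
      using d(2)[of z ?c] by (simp add: dist_norm)
  qed
  then have "d \<le> infdist z (span A)"
    unfolding infdist_def using span_zero[of A] by (auto intro!: cINF_greatest)
  with d(1) sp show ?thesis by simp
qed

text \<open>Extend from \<open>z\<close> below the distance to \<open>span B\<close>: the value at
  \<open>z\<close> is that distance, which is positive. Since the distance is even, it dominates the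
  modulus of the functional as well.\<close>

lemma norm_one_functional_vanishing_on_finite:
  fixes z :: "'a::real_normed_vector"
  assumes "finite B" "z \<notin> span B"
  obtains y :: "'a \<Rightarrow>\<^sub>L real" where "norm y = 1" "\<And>b. b \<in> B \<Longrightarrow> y b = 0" "y z \<noteq> 0"
proof -
  let ?p = "\<lambda>x. infdist x (span B)"
  obtain f where f: "linear f" "f \<le> ?p" "f z = ?p z"
    using hahn_banach_sublinear[OF sublinear_infdist_subspace[OF subspace_span]] by blast
  have abs_le: "\<bar>f x\<bar> \<le> ?p x" for x
  proof -
    have "?p (- x) \<le> dist x m" if "m \<in> span B" for m
      using infdist_le[OF span_neg[OF that], of "- x"]
      by (simp add: dist_norm norm_minus_commute)
    then have "?p (- x) \<le> ?p x"
      using span_zero[of B] by (subst (2) infdist_def) (auto intro!: cINF_greatest)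
    moreover have "f (- x) \<le> ?p (- x)" "f x \<le> ?p x" using f(2) by (auto simp: le_fun_def)
    ultimately show ?thesis using linear_neg[OF f(1), of x] by (simp add: abs_le_iff)
  qed
  have p_le: "?p x \<le> norm x" for x
    using infdist_le[OF span_zero, of x B] by simp
  have bl: "bounded_linear f"
    using f(1) abs_le p_le
    by (intro bounded_linear_intro[where K = 1]) (auto simp: linear_add linear_scale intro: order_trans)
  define g where "g = Blinfun f"
  have g: "blinfun_apply g = f" unfolding g_def using bl by (rule bounded_linear_Blinfun_apply)
  have gz: "g z \<noteq> 0" using infdist_span_finite_pos[OF assms] f(3) g by simp
  then have "g \<noteq> 0" by auto
  have "g b = 0" if "b \<in> B" for b
    using abs_le[of b] span_base[OF that] g by simp
  with gz \<open>g \<noteq> 0\<close> show ?thesis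
    by (intro that[of "g /\<^sub>R norm g"]) (auto simp: scaleR_blinfun.rep_eq)
qed

lemma infinite_dimensional_ex_annihilator:
  fixes A :: "'a::real_normed_vector set"
  assumes "\<not> finite_dimensional TYPE('a)" "finite A"
  obtains y :: "'a \<Rightarrow>\<^sub>L real" where "norm y = 1" "\<And>a. a \<in> A \<Longrightarrow> y a = 0"
proof -
  have "span A \<noteq> UNIV"
    using assms by (auto simp: finite_dimensional_def)
  then obtain z where "z \<notin> span A" by blast
  with assms(2) show ?thesis
    using norm_one_functional_vanishing_on_finite that by metis
qed

section \<open>Weak* topology and norm topology in finite dimensions\<close>

text \<open>The coefficients of a vector in a basis are bounded by a multiple of its norm, so the
  values on the basis control the functional.\<close>

lemma finite_dimensional_dual_norm_le:
  assumes "finite_dimensional TYPE('a::real_normed_vector)"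
  shows "\<exists>(B :: 'a set) C. finite B \<and> C \<ge> 0 \<and>
    (\<forall>y :: 'a \<Rightarrow>\<^sub>L real. norm y \<le> C * (\<Sum>b\<in>B. \<bar>blinfun_apply y b\<bar>))"
proof -
  obtain B0 :: "'a set" where B0: "finite B0" "span B0 = UNIV"
    using assms by (auto simp: finite_dimensional_def)
  obtain B where B: "B \<subseteq> B0" "independent B" "B0 \<subseteq> span B"
    using maximal_independent_subset by blast
  have sp: "span B = UNIV"
    using B B0 by (metis span_eq span_superset subset_trans)
  have fin: "finite B" using B(1) B0(1) finite_subset by blast
  obtain d where d: "d > 0" "\<And>c b. b \<in> B \<Longrightarrow> d * \<bar>c b\<bar> \<le> norm (\<Sum>b\<in>B. c b *\<^sub>R b)"
    using independent_coefficients_le_norm[OF fin B(2)] by blast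
  have "norm y \<le> inverse d * (\<Sum>b\<in>B. \<bar>y b\<bar>)" for y :: "'a \<Rightarrow>\<^sub>L real"
  proof (rule norm_blinfun_bound)
    fix x :: 'a
    have "x \<in> range (\<lambda>c. \<Sum>b\<in>B. c b *\<^sub>R b)"
      using sp span_finite[OF fin] by auto
    then obtain c where c: "x = (\<Sum>b\<in>B. c b *\<^sub>R b)" by blast
    have cb: "\<bar>c b\<bar> \<le> inverse d * norm x" if "b \<in> B" for b
      using d(2)[OF that, of c] d(1) c by (simp add: field_simps)
    have "norm (y x) = \<bar>\<Sum>b\<in>B. c b * y b\<bar>"
      by (simp add: c blinfun.sum_right blinfun.scaleR_right)
    also have "\<dots> \<le> (\<Sum>b\<in>B. \<bar>c b\<bar> * \<bar>y b\<bar>)"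
      by (rule order_trans[OF sum_abs]) (simp add: abs_mult)
    also have "\<dots> \<le> (\<Sum>b\<in>B. (inverse d * norm x) * \<bar>y b\<bar>)"
      using cb by (intro sum_mono mult_right_mono) auto
    also have "\<dots> = inverse d * (\<Sum>b\<in>B. \<bar>y b\<bar>) * norm x"
      by (simp add: sum_distrib_left sum_distrib_right mult_ac)
    finally show "norm (y x) \<le> inverse d * (\<Sum>b\<in>B. \<bar>y b\<bar>) * norm x" .
  qed (use d(1) in \<open>auto intro!: sum_nonneg\<close>)
  with fin d(1) show ?thesis by (intro exI[of _ B] exI[of _ "inverse d"]) auto
qed

text \<open>The norm distance to x is dominated by a finite sum of evaluations, whose sublevel sets
  are weak* open and lie in norm balls around x.\<close>

lemma finite_dimensional_weak_star_finer:
  assumes "finite_dimensional TYPE('a::real_normed_vector)"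
  shows "continuous_map (weak_star_topology :: ('a::real_normed_vector \<Rightarrow>\<^sub>L real) topology) euclidean (\<lambda>x. x)"
proof -
  obtain B :: "'a set" and C where BC: "finite B" "C \<ge> 0"
    "\<And>y :: 'a \<Rightarrow>\<^sub>L real. norm y \<le> C * (\<Sum>b\<in>B. \<bar>blinfun_apply y b\<bar>)"
    using finite_dimensional_dual_norm_le[OF assms] by blast
  have "openin weak_star_topology U" if U: "open U" for U :: "('a \<Rightarrow>\<^sub>L real) set"
  proof (subst openin_subopen, intro ballI)
    fix x assume "x \<in> U"
    then obtain e where e: "e > 0" "ball x e \<subseteq> U"
      using U by (meson openE)
    let ?g = "\<lambda>y. C * (\<Sum>b\<in>B. \<bar>blinfun_apply y b - x b\<bar>)"
    have "continuous_map weak_star_topology euclideanreal (\<lambda>y. \<bar>blinfun_apply y b - x b\<bar>)" for b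
      by (intro continuous_map_real_abs continuous_map_diff
          strong_operator_topology_continuous_evaluation) simp
    then have "continuous_map weak_star_topology euclideanreal ?g"
      using BC(1) by (intro continuous_map_real_mult continuous_map_sum) auto
    then have "openin weak_star_topology {y \<in> topspace weak_star_topology. ?g y \<in> {..<e}}"
      by (rule openin_continuous_map_preimage) auto
    moreover have "y \<in> U" if "?g y < e" for y
      using BC(3)[of "y - x"] that e(2)
      by (auto simp: blinfun.diff_left dist_norm norm_minus_commute subset_iff)
    ultimately show "\<exists>T. openin weak_star_topology T \<and> x \<in> T \<and> T \<subseteq> U"
      using e(1)
      by (intro exI[of _ "{y \<in> topspace weak_star_topology. ?g y \<in> {..<e}}"])
        (auto simp: strong_operator_topology_topspace)
  qed
  then show ?thesis
    by (auto simp: continuous_map_def strong_operator_topology_topspace)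
qed

section \<open>Weak* continuous functions\<close>

lemma C_ball_imp_continuous_on:
  assumes "f \<in> C_ball"
  shows "continuous_on dual_ball f"
proof -
  have "continuous_map (top_of_set dual_ball) (subtopology weak_star_topology dual_ball) (\<lambda>x. x)"
    by (intro continuous_map_into_subtopology continuous_map_from_subtopology
        strong_operator_topology_weaker_than_euclidean) auto
  then have "continuous_map (top_of_set dual_ball) euclideanreal (f \<circ> (\<lambda>x. x))"
    using assms by (intro continuous_map_compose) (auto simp: C_ball_def)
  then show ?thesis by (simp add: o_def)
qed

text \<open>Allows membership to be checked with norm continuity, which also covers the norm itself
  and radial rescalings.\<close>

lemma finite_dimensional_C_ballI:
  fixes f :: "('a::real_normed_vector \<Rightarrow>\<^sub>L real) \<Rightarrow> real"
  assumes fd: "finite_dimensional TYPE('a)"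
    and cont: "continuous_on dual_ball f" and zero: "\<And>x. x \<notin> dual_ball \<Longrightarrow> f x = 0"
  shows "f \<in> C_ball"
proof -
  have "continuous_map (subtopology weak_star_topology dual_ball)
      (top_of_set (dual_ball :: ('a \<Rightarrow>\<^sub>L real) set)) (\<lambda>x. x)"
    by (intro continuous_map_into_subtopology continuous_map_from_subtopology
        finite_dimensional_weak_star_finer fd) auto
  then have "continuous_map (subtopology weak_star_topology dual_ball) euclideanreal (f \<circ> (\<lambda>x. x))"
    using cont by (intro continuous_map_compose) auto
  then show ?thesis using zero by (simp add: o_def C_ball_def)
qed

text \<open>Finitely many vectors with one common tolerance: moving \<open>x\<close> inside the ball
  by a functional that vanishes on \<open>A\<close> changes \<open>f\<close> by less than
  \<open>e\<close>.\<close>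

lemma C_ball_nhd:
  assumes f: "f \<in> C_ball" and x: "x \<in> dual_ball" and e: "e > 0"
  obtains A d where "finite A" "d > 0"
    "\<And>y. y \<in> dual_ball \<Longrightarrow> (\<And>a. a \<in> A \<Longrightarrow> \<bar>y a - x a\<bar> < d) \<Longrightarrow> \<bar>f y - f x\<bar> < e"
proof -
  have "openin (subtopology weak_star_topology dual_ball)
      {y \<in> topspace (subtopology weak_star_topology dual_ball). f y \<in> ball (f x) e}"
    using f by (intro openin_continuous_map_preimage[where Y = euclideanreal]) (auto simp: C_ball_def)
  then have "\<exists>W. openin weak_star_topology W \<and> {y \<in> dual_ball. f y \<in> ball (f x) e} = W \<inter> dual_ball"
    unfolding openin_subtopology by (simp add: strong_operator_topology_topspace)
  then obtain W where W: "openin weak_star_topology W"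
    "{y \<in> dual_ball. f y \<in> ball (f x) e} = W \<inter> dual_ball"
    by blast
  then have "\<exists>V. open V \<and> W = blinfun_apply -` V"
    unfolding strong_operator_topology_def openin_pullback_topology by simp
  then obtain V where V: "open V" "W = blinfun_apply -` V"
    by blast
  have "x \<in> {y \<in> dual_ball. f y \<in> ball (f x) e}" using x e by simp
  then have "x \<in> W" unfolding W(2) by blast
  then have "blinfun_apply x \<in> V" using V(2) by simp
  moreover have "openin (product_topology (\<lambda>i. euclidean) UNIV) V"
    using V(1) by (simp add: open_fun_def)
  ultimately have "\<exists>X. blinfun_apply x \<in> Pi\<^sub>E UNIV X \<and> (\<forall>i. open (X i)) \<and>
      finite {i. X i \<noteq> UNIV} \<and> Pi\<^sub>E UNIV X \<subseteq> V"
    using product_topology_open_contains_basis[of "\<lambda>i. euclidean" UNIV V "blinfun_apply x"] by simp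
  then obtain X where X: "blinfun_apply x \<in> Pi\<^sub>E UNIV X" "\<And>i. open (X i)"
    "finite {i. X i \<noteq> UNIV}" "Pi\<^sub>E UNIV X \<subseteq> V"
    by blast
  define A where "A = {i. X i \<noteq> UNIV}"
  have "\<exists>r>0. ball (x a) r \<subseteq> X a" for a
    using X(1) X(2)[of a] open_contains_ball by (metis PiE_mem UNIV_I)
  then obtain r where r: "\<And>a. r a > 0" "\<And>a. ball (x a) (r a) \<subseteq> X a" by metis
  \<comment> \<open>A common radius for the finitely many restricted coordinates of the box; the 1
    covers the case that there are none.\<close>
  define d where "d = Min (insert 1 (r ` A))"
  have finA: "finite A" using X(3) by (simp add: A_def)
  have "d > 0"
    unfolding d_def using finA r(1) by (subst Min_gr_iff) auto
  moreover have "\<bar>f y - f x\<bar> < e" if y: "y \<in> dual_ball" "\<And>a. a \<in> A \<Longrightarrow> \<bar>y a - x a\<bar> < d" for y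
  proof -
    have "y i \<in> X i" for i
    proof (cases "i \<in> A")
      case True
      then have "d \<le> r i" unfolding d_def using finA by (intro Min_le) auto
      then have "y i \<in> ball (x i) (r i)"
        using y(2)[OF True] by (simp add: dist_real_def abs_minus_commute)
      then show ?thesis using r(2) by blast
    qed (simp add: A_def)
    then have "y \<in> W \<inter> dual_ball"
      using X(4) V(2) y(1) by auto
    then have "f y \<in> ball (f x) e" using W(2) by blast
    then show ?thesis by (simp add: dist_real_def abs_minus_commute)
  qed
  ultimately show ?thesis using finA that by blast
qed

lemma C_ball_add: "f \<in> C_ball \<Longrightarrow> g \<in> C_ball \<Longrightarrow> f + g \<in> C_ball"
  by (auto simp: C_ball_def plus_fun_def intro: continuous_map_add)

lemma C_ball_cmult: "f \<in> C_ball \<Longrightarrow> (\<lambda>x. c * f x) \<in> C_ball"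
  by (auto simp: C_ball_def intro: continuous_map_real_mult)

lemma C_ball_sup: "f \<in> C_ball \<Longrightarrow> g \<in> C_ball \<Longrightarrow> sup f g \<in> C_ball"
  by (auto simp: C_ball_def sup_fun_def sup_max intro: continuous_map_real_max)

lemma C_ball_inf: "f \<in> C_ball \<Longrightarrow> g \<in> C_ball \<Longrightarrow> inf f g \<in> C_ball"
  by (auto simp: C_ball_def inf_fun_def inf_min intro: continuous_map_real_min)

lemma C_ball_zero: "0 \<in> C_ball"
  by (auto simp: C_ball_def zero_fun_def)

lemma sublattice_Cph_ball: "sublattice Cph_ball C_ball"
proof -
  have max_mult: "max (t * a) (t * b) = t * max a b" "min (t * a) (t * b) = t * min a b"
    if "0 \<le> t" for t a b :: real
    using that by (auto simp: max_mult_distrib_left min_mult_distrib_left)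
  show ?thesis
    unfolding sublattice_def Cph_ball_def
    by (auto simp: C_ball_add C_ball_sup C_ball_inf C_ball_zero C_ball_cmult
        sup_max inf_min max_mult distrib_left)
qed

lemma Cph_ball_subset_C_ball: "Cph_ball \<subseteq> C_ball"
  by (auto simp: Cph_ball_def)

lemma Cph_ball_add: "f \<in> Cph_ball \<Longrightarrow> g \<in> Cph_ball \<Longrightarrow> f + g \<in> Cph_ball"
  and Cph_ball_sup: "f \<in> Cph_ball \<Longrightarrow> g \<in> Cph_ball \<Longrightarrow> sup f g \<in> Cph_ball"
  and Cph_ball_inf: "f \<in> Cph_ball \<Longrightarrow> g \<in> Cph_ball \<Longrightarrow> inf f g \<in> Cph_ball"
  and Cph_ball_cmult: "f \<in> Cph_ball \<Longrightarrow> (\<lambda>x. c * f x) \<in> Cph_ball"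
  and Cph_ball_zero: "0 \<in> Cph_ball"
  using sublattice_Cph_ball unfolding sublattice_def by blast+

lemma Cph_ball_diff:
  assumes "f \<in> Cph_ball" "g \<in> Cph_ball"
  shows "f - g \<in> Cph_ball"
proof -
  have "f + (\<lambda>x. (- 1) * g x) \<in> Cph_ball"
    using assms by (intro Cph_ball_add Cph_ball_cmult)
  moreover have "f + (\<lambda>x. (- 1) * g x) = f - g"
    by (auto simp: fun_eq_iff)
  ultimately show ?thesis by simp
qed

lemma Cph_ball_minus: "f \<in> Cph_ball \<Longrightarrow> - f \<in> Cph_ball"
  using Cph_ball_diff[OF Cph_ball_zero] by simp

lemma Cph_ball_outside: "f \<in> Cph_ball \<Longrightarrow> x \<notin> dual_ball \<Longrightarrow> f x = 0"
  by (auto simp: Cph_ball_def C_ball_def)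

lemma Cph_ball_scale: "f \<in> Cph_ball \<Longrightarrow> x \<in> dual_ball \<Longrightarrow> 0 \<le> t \<Longrightarrow> t \<le> 1 \<Longrightarrow> f (t *\<^sub>R x) = t * f x"
  by (auto simp: Cph_ball_def)

lemma Cph_ball_at_zero: "f \<in> Cph_ball \<Longrightarrow> f 0 = 0"
  using Cph_ball_scale[of f 0 0] by simp

lemma Cph_ball_normalize:
  assumes "f \<in> Cph_ball" "x \<in> dual_ball"
  shows "f x = norm x * f (x /\<^sub>R norm x)"
proof (cases "x = 0")
  case True
  then show ?thesis by (simp add: Cph_ball_at_zero[OF assms(1)])
next
  case False
  then show ?thesis
    using Cph_ball_scale[OF assms(1), of "x /\<^sub>R norm x" "norm x"] assms(2) by simp
qed

text \<open>Boundedness needs no compactness: a weak* neighbourhood of \<open>0\<close> contains a multiple of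
  the ball.\<close>

lemma Cph_ball_bounded:
  assumes f: "f \<in> Cph_ball"
  shows "bdd_above ((\<lambda>x. \<bar>f x\<bar>) ` dual_ball)"
proof -
  have "f \<in> C_ball" using f Cph_ball_subset_C_ball by blast
  then obtain A d where A: "finite A" "d > 0"
    "\<And>y. y \<in> dual_ball \<Longrightarrow> (\<And>a. a \<in> A \<Longrightarrow> \<bar>y a\<bar> < d) \<Longrightarrow> \<bar>f y\<bar> < 1"
    by (rule C_ball_nhd[where x = 0 and e = 1]) (auto simp: Cph_ball_at_zero[OF f])
  \<comment> \<open>Chosen to exceed |x a| for all a in \<open>A\<close> and x in the ball, and to
    be at least \<open>d\<close>: the factor d / s then keeps x in the ball and moves it into the
    neighbourhood of 0.\<close>
  define s where "s = d + 1 + (\<Sum>a\<in>A. norm a)"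
  have s: "s > 0" "d \<le> s"
    using A(2) sum_nonneg[of A norm] by (auto simp: s_def add_pos_nonneg)
  have "\<bar>f x\<bar> \<le> s / d" if x: "x \<in> dual_ball" for x
  proof -
    let ?y = "(d / s) *\<^sub>R x"
    have "\<bar>?y a\<bar> < d" if "a \<in> A" for a
    proof -
      have "\<bar>x a\<bar> \<le> norm x * norm a" using norm_blinfun[of x a] by simp
      also have "\<dots> \<le> norm a" using x by (simp add: mult_left_le_one_le)
      also have "\<dots> \<le> (\<Sum>a\<in>A. norm a)" using A(1) that by (intro member_le_sum) auto
      also have "\<dots> < s" using A(2) by (simp add: s_def)
      finally have "\<bar>x a\<bar> < s" .
      then show ?thesis using A(2) s by (simp add: blinfun.scaleR_left abs_mult field_simps)
    qed
    moreover have "?y \<in> dual_ball"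
      using x A(2) s mult_mono[of d s "norm x" 1] by simp
    ultimately have "\<bar>f ?y\<bar> < 1" using A(3) by blast
    then show ?thesis
      using Cph_ball_scale[OF f x, of "d / s"] A(2) s by (simp add: abs_mult field_simps)
  qed
  then show ?thesis by (rule bdd_aboveI2)
qed

section \<open>The unit ball as an order interval\<close>

text \<open>Extended by zero like the members of \<open>C_ball\<close>, so that it can be compared
  with them pointwise even where it fails to be weak* continuous.\<close>

definition ball_norm :: "('a::real_normed_vector \<Rightarrow>\<^sub>L real) \<Rightarrow> real" where
  "ball_norm x = (if x \<in> dual_ball then norm x else 0)"

text \<open>By homogeneity, a bound by 1 at the normalised point x / norm x becomes a bound by norm
  x at x.\<close>

lemma unit_ball_Cph_ball:
  "unit_ball Cph_ball sup_norm = {f \<in> Cph_ball. \<forall>x. \<bar>f x\<bar> \<le> ball_norm x}"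
proof -
  have "sup_norm f \<le> 1 \<longleftrightarrow> (\<forall>x. \<bar>f x\<bar> \<le> ball_norm x)" if f: "f \<in> Cph_ball" for f
  proof
    assume *: "sup_norm f \<le> 1"
    have le1: "\<bar>f x\<bar> \<le> 1" if "x \<in> dual_ball" for x
      using cSUP_upper[OF that Cph_ball_bounded[OF f]] * unfolding sup_norm_def by linarith
    show "\<forall>x. \<bar>f x\<bar> \<le> ball_norm x"
    proof
      fix x
      show "\<bar>f x\<bar> \<le> ball_norm x"
      proof (cases "x \<in> dual_ball")
        case True
        have "\<bar>f (x /\<^sub>R norm x)\<bar> \<le> 1" by (intro le1) (simp add: field_simps)
        then show ?thesis
          using Cph_ball_normalize[OF f True] True mult_left_le[of "\<bar>f (x /\<^sub>R norm x)\<bar>" "norm x"]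
          by (simp add: ball_norm_def abs_mult)
      qed (simp add: ball_norm_def Cph_ball_outside[OF f])
    qed
  next
    assume *: "\<forall>x. \<bar>f x\<bar> \<le> ball_norm x"
    have "\<bar>f x\<bar> \<le> 1" if "x \<in> dual_ball" for x
      using *[rule_format, of x] that by (simp add: ball_norm_def)
    then show "sup_norm f \<le> 1"
      unfolding sup_norm_def by (intro cSUP_least) auto
  qed
  then show ?thesis by (auto simp: unit_ball_def)
qed

lemma pos_unit_ball_Cph_ball:
  "pos_unit_ball Cph_ball sup_norm = {f \<in> Cph_ball. 0 \<le> f \<and> f \<le> ball_norm}"
  by (auto simp: pos_unit_ball_def unit_ball_Cph_ball le_fun_def)

lemma isLub_iff: "isLub F P f \<longleftrightarrow> f \<in> F \<and> (\<forall>p\<in>P. p \<le> f) \<and> (\<forall>h\<in>F. (\<forall>p\<in>P. p \<le> h) \<longrightarrow> f \<le> h)"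
  by (auto simp: isLub_def leastP_def isUb_def setle_def setge_def)

lemma isGlb_iff: "isGlb F P f \<longleftrightarrow> f \<in> F \<and> (\<forall>p\<in>P. f \<le> p) \<and> (\<forall>h\<in>F. (\<forall>p\<in>P. h \<le> p) \<longrightarrow> h \<le> f)"
  by (auto simp: isGlb_def greatestP_def isLb_def setle_def setge_def)

section \<open>Finite-dimensional spaces\<close>

lemma ball_norm_mem_Cph_ball:
  assumes "finite_dimensional TYPE('a::real_normed_vector)"
  shows "(ball_norm :: ('a \<Rightarrow>\<^sub>L real) \<Rightarrow> real) \<in> Cph_ball"
proof -
  have "continuous_on dual_ball (ball_norm :: ('a \<Rightarrow>\<^sub>L real) \<Rightarrow> real)"
    using continuous_on_norm_id by (rule continuous_on_eq) (simp add: ball_norm_def)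
  then have "(ball_norm :: ('a \<Rightarrow>\<^sub>L real) \<Rightarrow> real) \<in> C_ball"
    using assms by (intro finite_dimensional_C_ballI) (auto simp: ball_norm_def)
  then show ?thesis
    by (auto simp: Cph_ball_def ball_norm_def mult_le_one)
qed

text \<open>A positive value of \<open>g\<close> at \<open>z\<close> propagates along rays: \<open>x \<mapsto> norm x * max 0 (g (norm z * x / norm x))\<close>
  is again a lower bound, and it is positively homogeneous.\<close>

lemma finite_dimensional_regular:
  assumes fd: "finite_dimensional TYPE('a::real_normed_vector)"
  shows "regular_sublattice Cph_ball (C_ball :: (('a \<Rightarrow>\<^sub>L real) \<Rightarrow> real) set)"
  unfolding regular_sublattice_def
proof (intro conjI sublattice_Cph_ball allI impI, elim conjE)
  fix P :: "(('a \<Rightarrow>\<^sub>L real) \<Rightarrow> real) set"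
  assume P: "P \<subseteq> Cph_ball" "P \<noteq> {}" "isGlb Cph_ball P 0"
  have "g \<le> 0" if g: "g \<in> C_ball" "\<forall>p\<in>P. g \<le> p" for g
  proof (rule ccontr)
    assume "\<not> g \<le> 0"
    then obtain z where z: "g z > 0" by (auto simp: le_fun_def not_le)
    then have zb: "z \<in> dual_ball" using g(1) by (force simp: C_ball_def)
    obtain p0 where p0: "p0 \<in> P" using P(2) by blast
    \<comment> \<open>At the origin every member of \<open>P\<close> vanishes, so its minorant
      \<open>g\<close> is not positive there.\<close>
    have "z \<noteq> 0"
    proof
      assume "z = 0"
      moreover have "g 0 \<le> p0 0" using g(2) p0 by (auto simp: le_fun_def)
      moreover have "p0 0 = 0" using Cph_ball_at_zero p0 P(1) by blast
      ultimately show False using z by simp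
    qed
    define h where "h x = (if x \<in> dual_ball then norm x * max 0 (g ((norm z / norm x) *\<^sub>R x)) else 0)"
      for x
    have in_ball: "(norm z / norm x) *\<^sub>R x \<in> dual_ball" for x :: "'a \<Rightarrow>\<^sub>L real"
      using zb by (cases "x = 0") auto
    have gc: "continuous_on dual_ball g" using g(1) by (rule C_ball_imp_continuous_on)
    \<comment> \<open>Needed for continuity of \<open>h\<close> at 0: the direction of x has no
      limit there, so the factor norm x has to beat a bounded factor. The bound comes from
      \<open>p0\<close>, which lies above \<open>g\<close>.\<close>
    obtain M where M: "M \<ge> 0" "\<And>x. x \<in> dual_ball \<Longrightarrow> g x \<le> M"
    proof -
      obtain M where M: "\<And>x. x \<in> dual_ball \<Longrightarrow> \<bar>p0 x\<bar> \<le> M"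
        using Cph_ball_bounded[of p0] p0 P(1) unfolding bdd_above_def by blast
      have "g x \<le> M" if "x \<in> dual_ball" for x
      proof -
        have "g x \<le> p0 x" using g(2) p0 by (auto simp: le_fun_def)
        then show ?thesis using M[OF that] by linarith
      qed
      moreover have "M \<ge> 0" using M[of 0] by simp
      ultimately show ?thesis using that by blast
    qed
    have "continuous (at x within dual_ball) (\<lambda>x. norm x * max 0 (g ((norm z / norm x) *\<^sub>R x)))"
      if x: "x \<in> dual_ball" for x
    proof (cases "x = 0")
      case True
      have "((\<lambda>x. norm x * max 0 (g ((norm z / norm x) *\<^sub>R x))) \<longlongrightarrow> 0) (at 0 within dual_ball)"
      proof (rule Lim_null_comparison)
        show "\<forall>\<^sub>F x in at 0 within dual_ball.
            norm (norm x * max 0 (g ((norm z / norm x) *\<^sub>R x))) \<le> norm x * M"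
          using M in_ball by (intro always_eventually allI) (auto simp: intro!: mult_left_mono)
        have "((\<lambda>x::'a \<Rightarrow>\<^sub>L real. norm x * M) \<longlongrightarrow> norm (0::'a \<Rightarrow>\<^sub>L real) * M) (at 0 within dual_ball)"
          by (intro tendsto_mult_right tendsto_norm[OF tendsto_ident_at])
        then show "((\<lambda>x::'a \<Rightarrow>\<^sub>L real. norm x * M) \<longlongrightarrow> 0) (at 0 within dual_ball)" by simp
      qed
      then show ?thesis using True by (simp add: continuous_within)
    next
      case False
      have "continuous_on (dual_ball - {0}) (\<lambda>x. norm x * max 0 (g ((norm z / norm x) *\<^sub>R x)))"
        using in_ball by (intro continuous_intros continuous_on_compose2[OF gc]) auto
      then have "continuous (at x within dual_ball - {0}) (\<lambda>x. norm x * max 0 (g ((norm z / norm x) *\<^sub>R x)))"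
        using False x by (simp add: continuous_on_eq_continuous_within)
      moreover have "at x within dual_ball - {0} = at x within dual_ball"
        using False by (intro at_within_nhd[of _ "- {0}"]) auto
      ultimately show ?thesis by (simp add: continuous_within)
    qed
    then have "continuous_on dual_ball h"
      by (subst continuous_on_cong[OF refl, where g = "\<lambda>x. norm x * max 0 (g ((norm z / norm x) *\<^sub>R x))"])
        (auto simp: h_def continuous_on_eq_continuous_within)
    then have "h \<in> C_ball"
      using fd by (intro finite_dimensional_C_ballI) (auto simp: h_def)
    moreover have "h (t *\<^sub>R x) = t * h x" if "x \<in> dual_ball" "0 \<le> t" "t \<le> 1" for t x
      using that by (cases "t = 0") (auto simp: h_def mult_le_one)
    ultimately have hF: "h \<in> Cph_ball" by (auto simp: Cph_ball_def)
    moreover have "h \<le> p" if p: "p \<in> P" for p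
    proof (rule le_funI)
      fix x
      have pF: "p \<in> Cph_ball" and p_nonneg: "0 \<le> p x" and gp: "\<And>y. g y \<le> p y"
        using p P(1,3) g(2) by (auto simp: isGlb_iff le_fun_def)
      show "h x \<le> p x"
      proof (cases "x \<in> dual_ball \<and> x \<noteq> 0")
        case True
        let ?y = "x /\<^sub>R norm x"
        \<comment> \<open>The sampling point has norm at most 1, so a nonnegative homogeneous
          \<open>p\<close> is no larger there than at the end \<open>?y\<close> of its ray;
          homogeneity then returns to x.\<close>
        have "p ((norm z / norm x) *\<^sub>R x) = norm z * p ?y"
          using Cph_ball_scale[OF pF, of ?y "norm z"] True zb by (simp add: divide_inverse)
        moreover have "norm z * p ?y \<le> p ?y"
        proof -
          have "0 \<le> p ?y"
            using P(3) p by (auto simp: isGlb_iff le_fun_def)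
          then show ?thesis using zb by (simp add: mult_left_le_one_le)
        qed
        ultimately have "g ((norm z / norm x) *\<^sub>R x) \<le> p ?y"
          using gp[of "(norm z / norm x) *\<^sub>R x"] by linarith
        moreover have "0 \<le> p ?y" using P(3) p by (auto simp: isGlb_iff le_fun_def)
        ultimately have "norm x * max 0 (g ((norm z / norm x) *\<^sub>R x)) \<le> norm x * p ?y"
          by (intro mult_left_mono) auto
        then show ?thesis using Cph_ball_normalize[OF pF, of x] True by (simp add: h_def)
      qed (use p_nonneg in \<open>auto simp: h_def\<close>)
    qed
    ultimately have "h \<le> 0" using P(3) by (auto simp: isGlb_iff)
    moreover have "h z > 0" using z zb \<open>z \<noteq> 0\<close> by (simp add: h_def)
    ultimately show False using le_funD[of h 0 z] by simp
  qed
  then show "isGlb C_ball P 0"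
    using P(3) by (auto simp: isGlb_iff C_ball_zero)
qed

lemma order_adherence_superset: "A \<subseteq> F \<Longrightarrow> 0 \<in> F \<Longrightarrow> A \<subseteq> order_adherence F A"
proof
  fix f assume A: "A \<subseteq> F" "0 \<in> F" and f: "f \<in> A"
  have "decreases_to F {0} 0"
    using A(2) by (auto simp: decreases_to_def down_directed_def isGlb_iff)
  then have "order_converges F {()} (\<lambda>_ _. True) (\<lambda>_. f) f"
    using A f unfolding order_converges_def by (auto intro!: exI[of _ "{0}"])
  then show "f \<in> order_adherence F A"
    using f by (intro order_adherenceI[of "{()}" "\<lambda>_ _. True" "\<lambda>_. f"])
      (auto simp: directed_index_def reflp_on_def transp_on_def)
qed

text \<open>Every q in the bounding set dominates |f| - norm. This difference belongs to
  \<open>F\<close> because the norm does, so it lies below the infimum 0 taken in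
  \<open>F\<close>.\<close>

lemma finite_dimensional_unit_ball_order_closed:
  assumes "finite_dimensional TYPE('a::real_normed_vector)"
  shows "order_closed Cph_ball (unit_ball (Cph_ball :: (('a \<Rightarrow>\<^sub>L real) \<Rightarrow> real) set) sup_norm)"
proof -
  note u = ball_norm_mem_Cph_ball[OF assms]
  have "order_adherence Cph_ball (unit_ball Cph_ball sup_norm)
      \<subseteq> (unit_ball Cph_ball sup_norm :: (('a \<Rightarrow>\<^sub>L real) \<Rightarrow> real) set)"
  proof
    fix f :: "('a \<Rightarrow>\<^sub>L real) \<Rightarrow> real"
    assume "f \<in> order_adherence Cph_ball (unit_ball Cph_ball sup_norm)"
    then obtain I and r :: "(('a \<Rightarrow>\<^sub>L real) \<Rightarrow> real) \<Rightarrow> (('a \<Rightarrow>\<^sub>L real) \<Rightarrow> real) \<Rightarrow> bool" and n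
      where I: "directed_index I r" and n: "n ` I \<subseteq> unit_ball Cph_ball sup_norm"
        and conv: "order_converges Cph_ball I r n f"
      unfolding order_adherence_def by blast
    from conv obtain Q where f: "f \<in> Cph_ball" and Q: "decreases_to Cph_ball Q 0"
      and Qn: "\<And>q. q \<in> Q \<Longrightarrow> \<exists>i\<in>I. \<forall>p\<in>I. r i p \<longrightarrow> (\<forall>x. \<bar>n p x - f x\<bar> \<le> q x)"
      unfolding order_converges_def by blast
    have bound: "\<bar>f x\<bar> - ball_norm x \<le> q x" if q: "q \<in> Q" for q x
    proof -
      obtain i where i: "i \<in> I" "\<And>x. r i i \<Longrightarrow> \<bar>n i x - f x\<bar> \<le> q x"
        using Qn[OF q] by blast
      have "r i i" using I i(1) by (auto simp: directed_index_def reflp_on_def)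
      moreover have "\<bar>n i x\<bar> \<le> ball_norm x"
        using n i(1) by (auto simp: unit_ball_Cph_ball)
      ultimately show ?thesis using i(2)[of x] by linarith
    qed
    have glb: "h \<le> 0" if "h \<in> Cph_ball" "\<And>q. q \<in> Q \<Longrightarrow> h \<le> q" for h
      using Q that by (auto simp: decreases_to_def isGlb_iff)
    have "sup f (- f) - ball_norm \<le> 0"
      using bound by (intro glb Cph_ball_diff Cph_ball_sup Cph_ball_minus f u)
        (auto simp: le_fun_def sup_max abs_real_def max_def split: if_splits; smt)
    then have "\<bar>f x\<bar> \<le> ball_norm x" for x
      by (auto simp: le_fun_def sup_max dest!: spec[of _ x])
    then show "f \<in> unit_ball Cph_ball sup_norm"
      using f by (simp add: unit_ball_Cph_ball)
  qed
  moreover have "unit_ball Cph_ball sup_norm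
      \<subseteq> order_adherence Cph_ball (unit_ball Cph_ball sup_norm :: (('a \<Rightarrow>\<^sub>L real) \<Rightarrow> real) set)"
    by (intro order_adherence_superset) (auto simp: unit_ball_def Cph_ball_zero)
  ultimately show ?thesis by (auto simp: order_closed_def)
qed

lemma finite_dimensional_one_monotonically_bounded:
  assumes "finite_dimensional TYPE('a::real_normed_vector)"
  shows "one_monotonically_bounded (Cph_ball :: (('a \<Rightarrow>\<^sub>L real) \<Rightarrow> real) set) sup_norm"
proof -
  have "(ball_norm :: ('a \<Rightarrow>\<^sub>L real) \<Rightarrow> real) \<in> unit_ball Cph_ball sup_norm"
    using ball_norm_mem_Cph_ball[OF assms] by (auto simp: unit_ball_Cph_ball ball_norm_def)
  then show ?thesis
    unfolding one_monotonically_bounded_def pos_unit_ball_Cph_ball by blast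
qed

text \<open>The upper bound lies in \<open>F\<close>, so the supremum taken in \<open>F\<close> is
  below it. The dimension does not enter: the implication serves directly in one case and by
  contraposition in the other.\<close>

lemma one_monotonically_bounded_imp_semicontinuous:
  assumes "one_monotonically_bounded (Cph_ball :: (('a::real_normed_vector \<Rightarrow>\<^sub>L real) \<Rightarrow> real) set) sup_norm"
  shows "semicontinuous (Cph_ball :: (('a \<Rightarrow>\<^sub>L real) \<Rightarrow> real) set) sup_norm"
  unfolding semicontinuous_def
proof (intro allI ballI impI, elim conjE)
  fix P and f :: "('a \<Rightarrow>\<^sub>L real) \<Rightarrow> real"
  assume f: "f \<in> Cph_ball" and P: "P \<subseteq> pos_unit_ball Cph_ball sup_norm" "increases_to Cph_ball P f"
  obtain u where u: "u \<in> unit_ball Cph_ball sup_norm" "\<forall>p\<in>P. p \<le> u"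
    using assms P unfolding one_monotonically_bounded_def increases_to_def by blast
  have "f \<le> u" using P(2) u by (auto simp: increases_to_def isLub_iff unit_ball_def)
  moreover obtain p where "p \<in> P" using P(2) by (auto simp: increases_to_def up_directed_def)
  then have "0 \<le> p" "p \<le> f"
    using P by (auto simp: pos_unit_ball_def increases_to_def isLub_iff)
  then have "0 \<le> f" by (rule order_trans)
  moreover have "u x \<le> ball_norm x" for x
    using u(1) by (auto simp: unit_ball_Cph_ball dest: spec[of _ x])
  ultimately have "\<bar>f x\<bar> \<le> ball_norm x" for x
    by (auto simp: le_fun_def intro: order_trans)
  then have "f \<in> unit_ball Cph_ball sup_norm" using f by (simp add: unit_ball_Cph_ball)
  then show "sup_norm f \<le> 1" by (simp add: unit_ball_def)
qed

text \<open>Any positive value of \<open>f\<close> serves as the threshold: a family in s times the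
  ball is bounded by a multiple of the norm that belongs to \<open>F\<close>, hence so is
  \<open>f\<close>.\<close>

lemma finite_dimensional_pointwise_demicontinuous:
  assumes "finite_dimensional TYPE('a::real_normed_vector)"
  shows "pointwise_demicontinuous (Cph_ball :: (('a \<Rightarrow>\<^sub>L real) \<Rightarrow> real) set) sup_norm"
  unfolding pointwise_demicontinuous_def
proof (intro ballI impI)
  fix f :: "('a \<Rightarrow>\<^sub>L real) \<Rightarrow> real" assume "f \<in> Cph_ball" "0 < f"
  then obtain x where x: "f x > 0"
    by (auto simp: less_fun_def le_fun_def not_le)
  have "f x \<le> s" if P: "P \<subseteq> (\<lambda>g x. s * g x) ` pos_unit_ball Cph_ball sup_norm" "increases_to Cph_ball P f"
    for s P
  proof -
    \<comment> \<open>\<open>max 0 s\<close> because s may be negative, and then s times the norm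
      would not be an upper bound.\<close>
    have "p \<le> (\<lambda>x. max 0 s * ball_norm x)" if p: "p \<in> P" for p
    proof (rule le_funI)
      fix x
      obtain g where "g \<in> pos_unit_ball Cph_ball sup_norm" "p = (\<lambda>x. s * g x)"
        using P(1) p by blast
      then have g: "p = (\<lambda>x. s * g x)" "0 \<le> g x" "g x \<le> ball_norm x"
        by (auto simp: pos_unit_ball_Cph_ball le_fun_def)
      have "s * g x \<le> max 0 s * g x" using g(2) by (intro mult_right_mono) auto
      also have "\<dots> \<le> max 0 s * ball_norm x" using g(3) by (intro mult_left_mono) auto
      finally show "p x \<le> max 0 s * ball_norm x" by (simp add: g(1))
    qed
    then have "f \<le> (\<lambda>x. max 0 s * ball_norm x)"
      using P(2) Cph_ball_cmult[OF ball_norm_mem_Cph_ball[OF assms]]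
      by (auto simp: increases_to_def isLub_iff)
    then have "f x \<le> max 0 s * ball_norm x" by (simp add: le_fun_def)
    also have "\<dots> \<le> max 0 s" by (intro mult_left_le) (auto simp: ball_norm_def)
    finally show ?thesis using x by simp
  qed
  with x show "\<exists>t>0. \<forall>s P. P \<subseteq> (\<lambda>g x. s * g x) ` pos_unit_ball Cph_ball sup_norm \<and>
      increases_to Cph_ball P f \<longrightarrow> t \<le> s"
    by blast
qed

section \<open>Infinite-dimensional spaces\<close>

text \<open>The supply of explicit members of \<open>F\<close>: they provide the truncating
  functions and also a function outside the unit ball.\<close>

lemma pos_eval_mem_Cph_ball: "(\<lambda>x. if x \<in> dual_ball then max 0 (x e) else 0) \<in> Cph_ball"
proof -
  have "continuous_map (subtopology weak_star_topology dual_ball) euclideanreal (\<lambda>x. max 0 (x e))"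
    by (intro continuous_map_real_max continuous_map_from_subtopology
        strong_operator_topology_continuous_evaluation) simp
  then have "continuous_map (subtopology weak_star_topology dual_ball) euclideanreal
      (\<lambda>x. if x \<in> dual_ball then max 0 (x e) else 0)"
    by (rule continuous_map_eq) (auto simp: strong_operator_topology_topspace)
  then show ?thesis
    by (auto simp: Cph_ball_def C_ball_def blinfun.scaleR_left mult_le_one max_mult_distrib_left)
qed

text \<open>Where the upper bound \<open>h\<close> is smaller than \<open>f\<close>, shrink the argument and then move it by an
  annihilator of finitely many vectors: \<open>f\<close> changes little, but the norm gets large, so that \<open>f\<close> is
  below some evaluation \<open>e\<close> of norm at most \<open>1\<close> there and \<open>inf f e\<close> violates the bound.\<close>

lemma infinite_dimensional_truncations_increase:
  fixes f :: "('a::real_normed_vector \<Rightarrow>\<^sub>L real) \<Rightarrow> real"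
  assumes inf: "\<not> finite_dimensional TYPE('a)" and f: "f \<in> Cph_ball" "0 \<le> f"
  shows "increases_to Cph_ball {p \<in> pos_unit_ball Cph_ball sup_norm. p \<le> f} f"
proof -
  define P where "P = {p \<in> pos_unit_ball Cph_ball sup_norm. p \<le> f}"
  have f_nonneg: "0 \<le> f x" for x using f(2) by (simp add: le_fun_def)
  have "f \<le> h" if h: "h \<in> Cph_ball" "\<forall>p\<in>P. p \<le> h" for h
  proof (rule ccontr)
    assume "\<not> f \<le> h"
    then obtain z where z: "h z < f z" by (auto simp: le_fun_def not_le)
    then have zb: "z \<in> dual_ball"
      using Cph_ball_outside[OF f(1), of z] Cph_ball_outside[OF h(1), of z] by fastforce
    \<comment> \<open>The budget: f is below 1/4 at \<open>t *\<^sub>R z\<close> and changes by less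
      than 1/4, so it stays below 1/2. Adding 3/4 of a unit vector to a vector of norm at most 1/4
      gives a norm between 1/2 and 1.\<close>
    define t where "t = 1 / (4 * (1 + f z))"
    have t: "0 < t" "t \<le> 1/4" "t * f z < 1/4"
      using f_nonneg[of z] by (auto simp: t_def field_simps)
    have tz: "t *\<^sub>R z \<in> dual_ball" "norm (t *\<^sub>R z) \<le> 1/4"
      using t zb mult_mono[of t "1/4" "norm z" 1] by auto
    let ?g = "f - h"
    have gF: "?g \<in> Cph_ball" using f(1) h(1) by (rule Cph_ball_diff)
    have fC: "f \<in> C_ball" and gC: "?g \<in> C_ball"
      using f(1) gF Cph_ball_subset_C_ball by blast+
    have scale: "f (t *\<^sub>R z) = t * f z" "?g (t *\<^sub>R z) = t * ?g z"
      using t zb by (auto intro!: Cph_ball_scale f(1) gF simp del: minus_apply)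
    obtain A d where A: "finite A" "d > 0"
      "\<And>y. y \<in> dual_ball \<Longrightarrow> (\<And>a. a \<in> A \<Longrightarrow> \<bar>y a - (t *\<^sub>R z) a\<bar> < d) \<Longrightarrow> \<bar>f y - f (t *\<^sub>R z)\<bar> < 1/4"
      by (rule C_ball_nhd[OF fC tz(1), of "1/4"]) (simp, blast)
    \<comment> \<open>This number is the value of f - h at \<open>t *\<^sub>R z\<close>; taken as
      tolerance, it keeps f - h positive after the move.\<close>
    have "t * ?g z > 0" using t z by simp
    then obtain A' d' where A': "finite A'" "d' > 0"
      "\<And>y. y \<in> dual_ball \<Longrightarrow> (\<And>a. a \<in> A' \<Longrightarrow> \<bar>y a - (t *\<^sub>R z) a\<bar> < d') \<Longrightarrow> \<bar>?g y - ?g (t *\<^sub>R z)\<bar> < t * ?g z"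
      by (rule C_ball_nhd[OF gC tz(1)]) blast
    obtain y :: "'a \<Rightarrow>\<^sub>L real" where y: "norm y = 1" "\<And>a. a \<in> A \<union> A' \<Longrightarrow> y a = 0"
      using infinite_dimensional_ex_annihilator[OF inf, of "A \<union> A'"] A(1) A'(1) by auto
    define x where "x = t *\<^sub>R z + (3/4) *\<^sub>R y"
    have "norm x \<le> norm (t *\<^sub>R z) + norm ((3/4) *\<^sub>R y)"
      unfolding x_def by (rule norm_triangle_ineq)
    then have xb: "x \<in> dual_ball" using tz(2) y(1) by simp
    have "norm ((3/4) *\<^sub>R y) - norm (t *\<^sub>R z) \<le> norm x"
      unfolding x_def by (metis add.commute norm_diff_ineq)
    then have nx: "1/2 \<le> norm x" using tz(2) y(1) by simp
    have xa: "x a = (t *\<^sub>R z) a" if "a \<in> A \<union> A'" for a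
      using y(2)[OF that] by (simp add: x_def blinfun.add_left blinfun.scaleR_left)
    have "\<bar>f x - f (t *\<^sub>R z)\<bar> < 1/4"
      using xa A(2) by (intro A(3) xb) simp
    then have fx: "f x < norm x" using scale(1) t(3) nx by linarith
    have "\<bar>?g x - ?g (t *\<^sub>R z)\<bar> < t * ?g z"
      using xa A'(2) by (intro A'(3) xb) simp
    then have hx: "h x < f x" using scale(2) by simp
    \<comment> \<open>Since 0 \<le> f x < norm x, \<open>f x\<close> is not a valid operator bound
      for \<open>x\<close>; a vector witnessing this, normalised and with its sign adjusted, is
      \<open>e\<close>.\<close>
    obtain e where e: "norm e \<le> 1" "f x < x e"
    proof -
      have "\<exists>v. f x * norm v < \<bar>x v\<bar>"
        using norm_blinfun_bound[OF f_nonneg[of x], of x] fx by (auto simp: not_le[symmetric])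
      then obtain v where v: "f x * norm v < \<bar>x v\<bar>" by blast
      then have "v \<noteq> 0" by auto
      define w where "w = (sgn (x v) / norm v) *\<^sub>R v"
      have "x w = \<bar>x v\<bar> / norm v"
        by (simp add: w_def blinfun.scaleR_right abs_sgn mult.commute)
      then have "f x < x w" using v \<open>v \<noteq> 0\<close> by (simp add: pos_less_divide_eq)
      moreover have "norm w \<le> 1"
        using \<open>v \<noteq> 0\<close> by (simp add: w_def abs_sgn_eq)
      ultimately show ?thesis using that by blast
    qed
    let ?e = "\<lambda>x. if x \<in> dual_ball then max 0 (blinfun_apply x e) else 0"
    have "?e \<le> ball_norm"
    proof (rule le_funI)
      fix y :: "'a \<Rightarrow>\<^sub>L real"
      have "y e \<le> norm y * norm e" using norm_blinfun[of y e] by simp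
      also have "\<dots> \<le> norm y" using e(1) by (simp add: mult_left_le)
      finally show "?e y \<le> ball_norm y" by (simp add: ball_norm_def)
    qed
    then have "inf f ?e \<le> ball_norm"
      by (rule le_infI2)
    moreover have "0 \<le> inf f ?e" using f_nonneg by (auto simp: le_fun_def)
    moreover have "inf f ?e \<in> Cph_ball"
      by (intro Cph_ball_inf f(1) pos_eval_mem_Cph_ball)
    ultimately have "inf f ?e \<in> P"
      by (simp add: P_def pos_unit_ball_Cph_ball)
    with h(2) have "inf f ?e \<le> h" by blast
    then have "inf f ?e x \<le> h x" by (rule le_funD)
    then show False using hx e(2) xb by (auto simp: inf_min)
  qed
  moreover have "up_directed P"
  proof -
    have "0 \<in> P"
      using f by (auto simp: P_def pos_unit_ball_Cph_ball Cph_ball_zero ball_norm_def le_fun_def)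
    moreover have "sup p q \<in> P" if "p \<in> P" "q \<in> P" for p q
      using that by (auto simp: P_def pos_unit_ball_Cph_ball Cph_ball_sup le_supI1)
    ultimately show ?thesis
      unfolding up_directed_def by (meson empty_iff sup_ge1 sup_ge2)
  qed
  moreover have "P \<subseteq> Cph_ball" "\<forall>p\<in>P. p \<le> f"
    by (auto simp: P_def pos_unit_ball_Cph_ball)
  ultimately have "increases_to Cph_ball P f"
    using f(1) by (simp add: increases_to_def isLub_iff)
  then show ?thesis by (simp only: P_def)
qed

text \<open>Reflection at \<open>f\<close>: h is below all f - p exactly when f - h is above all p.
  It turns increasing families into the decreasing ones that order convergence and regularity speak
  of.\<close>

lemma decreases_to_diff:
  assumes f: "f \<in> Cph_ball" and P: "increases_to Cph_ball P f"
  shows "decreases_to Cph_ball ((\<lambda>p. f - p) ` P) 0"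
proof -
  have "h \<le> 0" if h: "h \<in> Cph_ball" "\<forall>q\<in>(\<lambda>p. f - p) ` P. h \<le> q" for h
  proof -
    have "p \<le> f - h" if "p \<in> P" for p
      using h(2) that by (fastforce simp: le_fun_def algebra_simps)
    then have "f \<le> f - h"
      using P Cph_ball_diff[OF f h(1)] by (auto simp: increases_to_def isLub_iff)
    then show ?thesis by (simp add: le_fun_def)
  qed
  moreover have "down_directed ((\<lambda>p. f - p) ` P)"
    unfolding down_directed_def
  proof (intro conjI ballI)
    show "(\<lambda>p. f - p) ` P \<noteq> {}" using P by (auto simp: increases_to_def up_directed_def)
    fix a b assume "a \<in> (\<lambda>p. f - p) ` P" "b \<in> (\<lambda>p. f - p) ` P"
    then obtain p q where pq: "p \<in> P" "q \<in> P" "a = f - p" "b = f - q" by blast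
    then obtain r where "r \<in> P" "p \<le> r" "q \<le> r"
      using P unfolding increases_to_def up_directed_def by blast
    with pq show "\<exists>c\<in>(\<lambda>p. f - p) ` P. c \<le> a \<and> c \<le> b"
      by (intro bexI[of _ "f - r"]) (auto simp: le_fun_def)
  qed
  ultimately show ?thesis
    using P f by (auto simp: decreases_to_def isGlb_iff increases_to_def isLub_iff
        Cph_ball_zero Cph_ball_diff le_fun_def subset_iff)
qed

lemma infinite_dimensional_anti_demicontinuous:
  assumes "\<not> finite_dimensional TYPE('a::real_normed_vector)"
  shows "anti_demicontinuous (Cph_ball :: (('a \<Rightarrow>\<^sub>L real) \<Rightarrow> real) set) sup_norm"
  unfolding anti_demicontinuous_def
proof (intro ballI impI exI conjI)
  fix f :: "('a \<Rightarrow>\<^sub>L real) \<Rightarrow> real" assume "f \<in> Cph_ball" "0 \<le> f"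
  then show "increases_to Cph_ball {p \<in> pos_unit_ball Cph_ball sup_norm. p \<le> f} f"
    by (rule infinite_dimensional_truncations_increase[OF assms])
qed blast

text \<open>If truncations \<open>p\<close> increase to \<open>\<bar>f\<bar>\<close>, then the truncations of \<open>f\<close> to \<open>[-p, p]\<close> converge to \<open>f\<close>
  with error exactly \<open>\<bar>f\<bar> - p\<close>.\<close>

lemma infinite_dimensional_order_adherence:
  assumes inf: "\<not> finite_dimensional TYPE('a::real_normed_vector)"
  shows "order_adherence Cph_ball (unit_ball (Cph_ball :: (('a \<Rightarrow>\<^sub>L real) \<Rightarrow> real) set) sup_norm) = Cph_ball"
proof
  show "order_adherence Cph_ball (unit_ball Cph_ball sup_norm) \<subseteq> (Cph_ball :: (('a \<Rightarrow>\<^sub>L real) \<Rightarrow> real) set)"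
    by (auto simp: order_adherence_def order_converges_def)
next
  show "(Cph_ball :: (('a \<Rightarrow>\<^sub>L real) \<Rightarrow> real) set) \<subseteq> order_adherence Cph_ball (unit_ball Cph_ball sup_norm)"
  proof
    fix f :: "('a \<Rightarrow>\<^sub>L real) \<Rightarrow> real" assume f: "f \<in> Cph_ball"
    define m where "m = sup f (- f)"
    have m: "m \<in> Cph_ball" "0 \<le> m" and m_abs: "m x = \<bar>f x\<bar>" for x
      using f by (auto simp: m_def Cph_ball_sup Cph_ball_minus le_fun_def sup_max)
    define P where "P = {p \<in> pos_unit_ball Cph_ball sup_norm. p \<le> m}"
    have P: "increases_to Cph_ball P m"
      unfolding P_def by (rule infinite_dimensional_truncations_increase[OF inf m])
    have PD: "p \<in> Cph_ball" "0 \<le> p x" "p x \<le> ball_norm x" "p x \<le> \<bar>f x\<bar>" if "p \<in> P" for p x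
      using that m_abs[symmetric] by (auto simp: P_def pos_unit_ball_Cph_ball le_fun_def)
    let ?n = "\<lambda>p. sup (inf f p) (- p)"
    have n_le: "\<bar>?n p x\<bar> \<le> p x" and n_diff: "\<bar>?n p x - f x\<bar> = \<bar>f x\<bar> - p x" if "p \<in> P" for p x
      using PD(2,4)[OF that, of x] by (auto simp: sup_max inf_min max_def min_def abs_if)
    have "?n ` P \<subseteq> unit_ball Cph_ball sup_norm"
      using PD n_le order_trans
      by (auto simp: unit_ball_Cph_ball f Cph_ball_sup Cph_ball_inf Cph_ball_minus simp del: sup_apply inf_apply; blast)
    moreover have "order_converges Cph_ball P (\<le>) ?n f"
    proof -
      have "decreases_to Cph_ball ((\<lambda>p. m - p) ` P) 0"
        using decreases_to_diff[OF m(1) P] .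
      moreover have "\<exists>i\<in>P. \<forall>p\<in>P. i \<le> p \<longrightarrow> (\<forall>x. \<bar>?n p x - f x\<bar> \<le> (m - q) x)" if q: "q \<in> P" for q
      proof (intro bexI[OF _ q] ballI impI allI)
        fix p x assume "p \<in> P" "q \<le> p"
        then show "\<bar>?n p x - f x\<bar> \<le> (m - q) x"
          using n_diff[of p x] by (simp add: m_abs le_fun_def)
      qed
      ultimately show ?thesis
        unfolding order_converges_def
        using f \<open>?n ` P \<subseteq> unit_ball Cph_ball sup_norm\<close> by (auto simp: unit_ball_def image_subset_iff)
    qed
    moreover have "directed_index P (\<le>)"
      using P by (auto simp: directed_index_def increases_to_def up_directed_def reflp_on_def transp_on_def)
    ultimately show "f \<in> order_adherence Cph_ball (unit_ball Cph_ball sup_norm)"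
      by (intro order_adherenceI)
  qed
qed

section \<open>Anti-demicontinuity refutes the other conditions\<close>

lemma increases_to_cmult:
  assumes "s > 0" "increases_to Cph_ball P f"
  shows "increases_to Cph_ball ((\<lambda>g x. s * g x) ` P) (\<lambda>x. s * f x)"
proof -
  let ?S = "\<lambda>c g (x :: 'a \<Rightarrow>\<^sub>L real). c * g x :: real"
  have mono: "g \<le> h \<Longrightarrow> ?S s g \<le> ?S s h" for g h
    using assms(1) by (auto simp: le_fun_def)
  have "?S s f \<le> h" if h: "h \<in> Cph_ball" "\<forall>p\<in>?S s ` P. p \<le> h" for h
  proof -
    have "f \<le> ?S (inverse s) h"
    proof -
      have "p \<le> ?S (inverse s) h" if "p \<in> P" for p
      proof -
        have "?S s p \<le> h" using h(2) that by blast
        then show ?thesis using assms(1) by (auto simp: le_fun_def field_simps)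
      qed
      then show ?thesis
        using assms(2) Cph_ball_cmult[OF h(1)] by (auto simp: increases_to_def isLub_iff)
    qed
    then show ?thesis using assms(1) by (auto simp: le_fun_def field_simps)
  qed
  moreover have "up_directed (?S s ` P)"
    using assms(2) mono unfolding increases_to_def up_directed_def by blast
  ultimately show ?thesis
    using assms(2) mono by (auto simp: increases_to_def isLub_iff Cph_ball_cmult subset_iff)
qed

text \<open>The common counterexample: a value above norm y puts \<open>f\<close> outside the unit
  ball, and 2 leaves f - 1 positive at \<open>y\<close>.\<close>

lemma ex_Cph_ball_large_value:
  fixes z :: "'a::real_normed_vector"
  assumes "z \<noteq> 0"
  obtains f and y :: "'a \<Rightarrow>\<^sub>L real" where "f \<in> Cph_ball" "0 \<le> f" "norm y = 1" "f y = 2"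
proof -
  obtain y :: "'a \<Rightarrow>\<^sub>L real" where y: "norm y = 1" "y z \<noteq> 0"
    using norm_one_functional_vanishing_on_finite[of "{}" z] assms by auto
  define e where "e = (2 / y z) *\<^sub>R z"
  have "y e = 2" using y(2) by (simp add: e_def blinfun.scaleR_right)
  with y(1) show ?thesis
    by (intro that[OF pos_eval_mem_Cph_ball[of e], of y]) (auto simp: le_fun_def)
qed

lemma unit_ball_Cph_ball_ne:
  fixes z :: "'a::real_normed_vector"
  assumes "z \<noteq> 0"
  shows "unit_ball (Cph_ball :: (('a \<Rightarrow>\<^sub>L real) \<Rightarrow> real) set) sup_norm \<noteq> Cph_ball"
proof -
  obtain f and y :: "'a \<Rightarrow>\<^sub>L real" where f: "f \<in> Cph_ball" "norm y = 1" "f y = 2"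
    using ex_Cph_ball_large_value[OF assms] by blast
  then have "\<not> \<bar>f y\<bar> \<le> ball_norm y" by (simp add: ball_norm_def)
  then have "f \<notin> unit_ball Cph_ball sup_norm" by (auto simp: unit_ball_Cph_ball)
  with f(1) show ?thesis by blast
qed

lemma semicontinuous_imp_not_anti_demicontinuous:
  fixes z :: "'a::real_normed_vector"
  assumes "z \<noteq> 0" and semi: "semicontinuous (Cph_ball :: (('a \<Rightarrow>\<^sub>L real) \<Rightarrow> real) set) sup_norm"
  shows "\<not> anti_demicontinuous (Cph_ball :: (('a \<Rightarrow>\<^sub>L real) \<Rightarrow> real) set) sup_norm"
proof
  assume anti: "anti_demicontinuous (Cph_ball :: (('a \<Rightarrow>\<^sub>L real) \<Rightarrow> real) set) sup_norm"
  obtain f and y :: "'a \<Rightarrow>\<^sub>L real" where f: "f \<in> Cph_ball" "0 \<le> f" "norm y = 1" "f y = 2"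
    using ex_Cph_ball_large_value[OF assms(1)] by blast
  then have "f \<in> unit_ball Cph_ball sup_norm"
    using anti semi unfolding anti_demicontinuous_def semicontinuous_def unit_ball_def by blast
  then have "\<bar>f y\<bar> \<le> ball_norm y" by (auto simp: unit_ball_Cph_ball)
  then show False using f by (simp add: ball_norm_def)
qed

lemma pointwise_demicontinuous_imp_not_anti_demicontinuous:
  fixes z :: "'a::real_normed_vector"
  assumes "z \<noteq> 0" and demi: "pointwise_demicontinuous (Cph_ball :: (('a \<Rightarrow>\<^sub>L real) \<Rightarrow> real) set) sup_norm"
  shows "\<not> anti_demicontinuous (Cph_ball :: (('a \<Rightarrow>\<^sub>L real) \<Rightarrow> real) set) sup_norm"
proof
  assume anti: "anti_demicontinuous (Cph_ball :: (('a \<Rightarrow>\<^sub>L real) \<Rightarrow> real) set) sup_norm"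
  obtain f and y :: "'a \<Rightarrow>\<^sub>L real" where f: "f \<in> Cph_ball" "0 \<le> f" "f y = 2"
    using ex_Cph_ball_large_value[OF assms(1)] by blast
  then have "f \<noteq> 0" by auto
  with f(2) have "0 < f" by simp
  then have "\<exists>t>0. \<forall>s P. P \<subseteq> (\<lambda>g x. s * g x) ` pos_unit_ball Cph_ball sup_norm \<and>
      increases_to Cph_ball P f \<longrightarrow> t \<le> s"
    using demi f(1) by (simp add: pointwise_demicontinuous_def)
  then obtain t where t: "t > 0" "\<forall>s P. P \<subseteq> (\<lambda>g x. s * g x) ` pos_unit_ball Cph_ball sup_norm \<and>
      increases_to Cph_ball P f \<longrightarrow> t \<le> s"
    by (elim exE conjE)
  \<comment> \<open>A family in the unit ball increasing to (2 / t) f becomes, after multiplication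
    by t / 2, a family increasing to \<open>f\<close> with s = t / 2, below the threshold
    \<open>t\<close>.\<close>
  have "(\<lambda>x. (2 / t) * f x) \<in> Cph_ball" "0 \<le> (\<lambda>x. (2 / t) * f x)"
    using f t(1) by (auto simp: Cph_ball_cmult le_fun_def simp del: times_divide_eq_left)
  then obtain P where P: "P \<subseteq> pos_unit_ball Cph_ball sup_norm" "increases_to Cph_ball P (\<lambda>x. (2 / t) * f x)"
    using anti unfolding anti_demicontinuous_def by blast
  have "increases_to Cph_ball ((\<lambda>g x. (t / 2) * g x) ` P) (\<lambda>x. (t / 2) * ((2 / t) * f x))"
    using t(1) P(2) by (intro increases_to_cmult) auto
  also have "(\<lambda>x. (t / 2) * ((2 / t) * f x)) = f"
    using t(1) by (simp add: fun_eq_iff)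
  finally have "t \<le> t / 2"
    using image_mono[OF P(1)] by (intro t(2)[rule_format] conjI)
  then show False using t(1) by simp
qed

text \<open>If \<open>P\<close> increases to \<open>f\<close> inside the unit ball, then \<open>f - P\<close> decreases to \<open>0\<close> in the sublattice,
  while \<open>f - 1\<close> is a lower bound of it among all continuous functions.\<close>

lemma regular_imp_not_anti_demicontinuous:
  fixes z :: "'a::real_normed_vector"
  assumes "z \<noteq> 0" and reg: "regular_sublattice Cph_ball (C_ball :: (('a \<Rightarrow>\<^sub>L real) \<Rightarrow> real) set)"
  shows "\<not> anti_demicontinuous (Cph_ball :: (('a \<Rightarrow>\<^sub>L real) \<Rightarrow> real) set) sup_norm"
proof
  assume anti: "anti_demicontinuous (Cph_ball :: (('a \<Rightarrow>\<^sub>L real) \<Rightarrow> real) set) sup_norm"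
  obtain f and y :: "'a \<Rightarrow>\<^sub>L real" where f: "f \<in> Cph_ball" "0 \<le> f" "norm y = 1" "f y = 2"
    using ex_Cph_ball_large_value[OF assms(1)] by blast
  then obtain P where P: "P \<subseteq> pos_unit_ball Cph_ball sup_norm" "increases_to Cph_ball P f"
    using anti unfolding anti_demicontinuous_def by blast
  have "decreases_to Cph_ball ((\<lambda>p. f - p) ` P) 0"
    by (rule decreases_to_diff[OF f(1) P(2)])
  then have glb: "isGlb C_ball ((\<lambda>p. f - p) ` P) 0"
    using reg unfolding regular_sublattice_def decreases_to_def down_directed_def by blast
  \<comment> \<open>The 1 is subtracted only on the ball, which keeps \<open>g\<close> in
    \<open>C_ball\<close>; members of \<open>P\<close> are at most 1 there.\<close>
  define g where "g x = (if x \<in> dual_ball then f x - 1 else 0)" for x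
  have "continuous_map (subtopology weak_star_topology dual_ball) euclideanreal (\<lambda>x. f x - 1)"
    using f(1) by (intro continuous_map_diff) (auto simp: Cph_ball_def C_ball_def)
  then have "continuous_map (subtopology weak_star_topology dual_ball) euclideanreal g"
    by (rule continuous_map_eq) (auto simp: g_def strong_operator_topology_topspace)
  then have "g \<in> C_ball" by (auto simp: C_ball_def g_def)
  moreover have "g \<le> f - p" if "p \<in> P" for p
  proof (rule le_funI)
    fix x
    have "p x \<le> ball_norm x" "p \<in> Cph_ball"
      using P(1) that by (auto simp: pos_unit_ball_Cph_ball le_fun_def)
    then show "g x \<le> (f - p) x"
      using Cph_ball_outside[of p x] Cph_ball_outside[OF f(1), of x] by (auto simp: g_def ball_norm_def split: if_splits)
  qed
  ultimately have "g \<le> 0" using glb by (auto simp: isGlb_iff)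
  moreover have "g y = 1" using f(3,4) by (simp add: g_def)
  ultimately show False using le_funD[of g 0 y] by simp
qed

theorem theorem8p1:
  fixes F :: "(('a::real_normed_vector \<Rightarrow>\<^sub>L real) \<Rightarrow> real) set"
  assumes F_def: "F = Cph_ball"
  shows
    "(finite_dimensional TYPE('a) \<longleftrightarrow> regular_sublattice F C_ball) \<and>
     (finite_dimensional TYPE('a) \<longleftrightarrow> one_monotonically_bounded F sup_norm) \<and>
     (finite_dimensional TYPE('a) \<longleftrightarrow> semicontinuous F sup_norm) \<and>
     (finite_dimensional TYPE('a) \<longleftrightarrow> order_closed F (unit_ball F sup_norm)) \<and>
     (finite_dimensional TYPE('a) \<longleftrightarrow> pointwise_demicontinuous F sup_norm) \<and>
     ((\<exists>x::'a. x \<noteq> 0) \<longrightarrow>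
        (finite_dimensional TYPE('a) \<longleftrightarrow> \<not> anti_demicontinuous F sup_norm) \<and>
        (finite_dimensional TYPE('a) \<longleftrightarrow> order_adherence F (unit_ball F sup_norm) \<noteq> F))"
proof (cases "finite_dimensional TYPE('a)")
  case True
  have mono: "one_monotonically_bounded (Cph_ball :: (('a \<Rightarrow>\<^sub>L real) \<Rightarrow> real) set) sup_norm"
    by (rule finite_dimensional_one_monotonically_bounded[OF True])
  note semi = one_monotonically_bounded_imp_semicontinuous[OF mono]
  have closed: "order_closed Cph_ball (unit_ball (Cph_ball :: (('a \<Rightarrow>\<^sub>L real) \<Rightarrow> real) set) sup_norm)"
    by (rule finite_dimensional_unit_ball_order_closed[OF True])
  have "\<not> anti_demicontinuous (Cph_ball :: (('a \<Rightarrow>\<^sub>L real) \<Rightarrow> real) set) sup_norm \<and>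
      order_adherence Cph_ball (unit_ball (Cph_ball :: (('a \<Rightarrow>\<^sub>L real) \<Rightarrow> real) set) sup_norm) \<noteq> Cph_ball"
    if ex: "\<exists>x::'a. x \<noteq> 0"
  proof -
    obtain z :: 'a where z: "z \<noteq> 0" using ex by blast
    show ?thesis
      using semicontinuous_imp_not_anti_demicontinuous[OF z semi] unit_ball_Cph_ball_ne[OF z] closed
      unfolding order_closed_def by simp
  qed
  then show ?thesis
    by (simp add: F_def True mono semi closed finite_dimensional_regular
        finite_dimensional_pointwise_demicontinuous)
next
  case False
  \<comment> \<open>The empty set spans {0}, so infinite dimension supplies the nonzero vector that
    the refutations require.\<close>
  then have "span {} \<noteq> (UNIV :: 'a set)"
    unfolding finite_dimensional_def by blast
  then obtain z :: 'a where z: "z \<noteq> 0" by auto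
  note anti = infinite_dimensional_anti_demicontinuous[OF False]
  note adh = infinite_dimensional_order_adherence[OF False]
  have semi: "\<not> semicontinuous (Cph_ball :: (('a \<Rightarrow>\<^sub>L real) \<Rightarrow> real) set) sup_norm"
    using semicontinuous_imp_not_anti_demicontinuous[OF z] anti by blast
  moreover have "\<not> one_monotonically_bounded (Cph_ball :: (('a \<Rightarrow>\<^sub>L real) \<Rightarrow> real) set) sup_norm"
    using semi one_monotonically_bounded_imp_semicontinuous by blast
  moreover have "\<not> regular_sublattice (Cph_ball :: (('a \<Rightarrow>\<^sub>L real) \<Rightarrow> real) set) C_ball"
    using regular_imp_not_anti_demicontinuous[OF z] anti by blast
  moreover have "\<not> pointwise_demicontinuous (Cph_ball :: (('a \<Rightarrow>\<^sub>L real) \<Rightarrow> real) set) sup_norm"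
    using pointwise_demicontinuous_imp_not_anti_demicontinuous[OF z] anti by blast
  moreover have "\<not> order_closed Cph_ball (unit_ball (Cph_ball :: (('a \<Rightarrow>\<^sub>L real) \<Rightarrow> real) set) sup_norm)"
    using unit_ball_Cph_ball_ne[OF z] adh unfolding order_closed_def by simp
  ultimately show ?thesis
    by (simp add: F_def False anti adh)
qed

end
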